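(* Let $T$ be a closed Hamiltonian operator matrix on $H\times H$ with a finitely spectral Riesz basis of subspaces $(V_k)_{k\in\mathbb N}$. Then $T$ admits a subspace of $H\times H$ that is hypermaximal $J_1$-neutral, $T$-invariant and compatible with $(V_k)_{k\in\mathbb N}$ if and only if for every $it\in\sigma_p^i(T)$ ($t\in\mathbb R$) there is a decomposition $$\mathcal L(it)=M_{it}\oplus N_{it}\quad\text{with } M_{it},N_{it}\ J_1\text{-neutral and } M_{it}\ T\text{-invariant}.\qquad( * )$$ In this case, given subspaces $M_{it}$, $N_{it}$ as in $( * )$, for every sc-set $\sigma\subset\sigma_p(T)\setminus i\mathbb R$ the $T$-invariant compatible subspace $$U=\overline{\sum_{\lambda\in\sigma}\mathcal L(\lambda)+\sum_{it\in\sigma_p^i(T)}M_{it}}$$ is hypermaximal $J_1$-neutral.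
   Context: $H$ is a complex separable Hilbert space with scalar product $(\cdot|\cdot)$, linear in the first argument. Hamiltonian operator matrix: a block operator matrix $T=\begin{pmatrix}A&B\\C&-A^*\end{pmatrix}$ on $H\times H$ with domain $\mathcal D(T)=(\mathcal D(A)\cap\mathcal D(C))\times(\mathcal D(A^* )\cap\mathcal D(B))$, where $A,B,C$ are densely defined linear operators on $H$, $B$ and $C$ are symmetric, and $T$ is densely defined. $J_1=\begin{pmatrix}0&-iI\\ iI&0\end{pmatrix}$ and $\langle x|y\rangle=(J_1x|y)$ on $H\times H$. For a subspace $U$, $U^{\langle\perp\rangle}=\{x:\langle x|y\rangle=0\text{ for all }y\in U\}$. $U$ is $J_1$-neutral if $\langle x|x\rangle=0$ for all $x\in U$ (equivalently $U\subset U^{\langle\perp\rangle}$), and hypermaximal $J_1$-neutral if $U=U^{\langle\perp\rangle}$. Riesz basis of subspaces of a separable Hilbert space $V$: a sequence $(V_k)_{k\in\mathbb N}$ of closed subspaces (possibly some equal to $\{0\}$) such that for some isomorphism $\Phi:V\to V$ the subspaces $\Phi(V_k)$ are pairwise orthogonal with dense linear span. Every $x\in V$ then has a unique expansion $x=\sum_kx_k$, $x_k\in V_k$. For closed subspaces $U_k\subset V_k$ one writes $\bigoplus^2_{k}U_k=\overline{\sum_kU_k}$; a subspace $U$ is compatible with $(V_k)$ if $U=\bigoplus^2_kU_k$ for some closed $U_k\subset V_k$. The Riesz basis $(V_k)$ is finitely spectral for a closed operator $T$ if each $V_k$ is finite-dimensional, $V_k\subset\mathcal D(T)$, $V_k$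 is $T$-invariant, the sets $\sigma(T|_{V_k})$ are pairwise disjoint, and $\sum_kV_k$ is a core for $T$ (for every $x\in\mathcal D(T)$ there are $x_n\in\sum_kV_k$ with $x_n\to x$, $Tx_n\to Tx$). A subspace $U$ is $T$-invariant if $T(U\cap\mathcal D(T))\subset U$. $\mathcal L(\lambda)=\bigcup_{k}\ker(T-\lambda)^k$ is the root subspace for $\lambda\in\sigma_p(T)$, and $\sigma_p^i(T)=\sigma_p(T)\cap i\mathbb R$. For a Hamiltonian with a finitely spectral Riesz basis of subspaces, $\sigma_p(T)$ is symmetric with respect to the imaginary axis. A subset $\sigma\subset\sigma_p(T)\setminus i\mathbb R$ is an sc-set if (i) $\lambda\in\sigma\Rightarrow-\overline\lambda\notin\sigma$, and (ii) $\lambda\in\sigma_p(T)\setminus i\mathbb R\Rightarrow\lambda\in\sigma$ or $-\overline\lambda\in\sigma$. *)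

theory Defs
  imports "HOL-Analysis.Analysis"
begin

section \<open>Complex Hilbert spaces\<close>

text \<open>
  The real structure of a complex inner product space (norm, topology, real inner product) is the one
  of \<open>real_inner\<close>; the scalar product is linear in the first argument and its real part
  is the real inner product, so that \<open>norm x = sqrt (Re (cinner x x))\<close>.
\<close>

class complex_inner = real_inner +
  fixes scaleC :: "complex \<Rightarrow> 'a \<Rightarrow> 'a" (infixr "*\<^sub>C" 75)
    and cinner :: "'a \<Rightarrow> 'a \<Rightarrow> complex"
  assumes scaleC_add_right: "c *\<^sub>C (x + y) = c *\<^sub>C x + c *\<^sub>C y"
    and scaleC_add_left: "(c + d) *\<^sub>C x = c *\<^sub>C x + d *\<^sub>C x"
    and scaleC_scaleC: "c *\<^sub>C d *\<^sub>C x = (c * d) *\<^sub>C x"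
    and scaleR_scaleC: "scaleR r x = complex_of_real r *\<^sub>C x"
    and cinner_commute: "cinner x y = cnj (cinner y x)"
    and cinner_add_left: "cinner (x + y) z = cinner x z + cinner y z"
    and cinner_scaleC_left: "cinner (c *\<^sub>C x) y = c * cinner x y"
    and inner_eq_Re_cinner: "inner x y = Re (cinner x y)"

class chilbert_space = complex_inner + complete_space

lemma scaleC_one: "1 *\<^sub>C x = (x :: 'a::complex_inner)"
  using scaleR_scaleC[of 1 x] by simp

global_interpretation complex_vector:
  vector_space "scaleC :: complex \<Rightarrow> 'a \<Rightarrow> 'a::complex_inner"
  defines csubspace = complex_vector.subspace
    and cspan = complex_vector.span
  by unfold_locales (simp_all add: scaleC_add_right scaleC_add_left scaleC_scaleC scaleC_one)

instantiation prod :: (complex_inner, complex_inner) complex_inner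
begin

definition scaleC_prod :: "complex \<Rightarrow> 'a \<times> 'b \<Rightarrow> 'a \<times> 'b"
  where "scaleC_prod c x = (c *\<^sub>C fst x, c *\<^sub>C snd x)"

definition cinner_prod :: "'a \<times> 'b \<Rightarrow> 'a \<times> 'b \<Rightarrow> complex"
  where "cinner_prod x y = cinner (fst x) (fst y) + cinner (snd x) (snd y)"

instance
proof
  fix x y z :: "'a \<times> 'b" and c d :: complex and r :: real
  show "c *\<^sub>C (x + y) = c *\<^sub>C x + c *\<^sub>C y"
    by (simp add: scaleC_prod_def scaleC_add_right)
  show "(c + d) *\<^sub>C x = c *\<^sub>C x + d *\<^sub>C x"
    by (simp add: scaleC_prod_def scaleC_add_left)
  show "c *\<^sub>C d *\<^sub>C x = (c * d) *\<^sub>C x"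
    by (simp add: scaleC_prod_def scaleC_scaleC)
  show "scaleR r x = complex_of_real r *\<^sub>C x"
    by (simp add: scaleC_prod_def scaleR_prod_def scaleR_scaleC)
  show "cinner x y = cnj (cinner y x)"
    using cinner_commute[of "fst x" "fst y"] cinner_commute[of "snd x" "snd y"]
    by (simp add: cinner_prod_def)
  show "cinner (x + y) z = cinner x z + cinner y z"
    by (simp add: cinner_prod_def cinner_add_left)
  show "cinner (c *\<^sub>C x) y = c * cinner x y"
    by (simp add: cinner_prod_def scaleC_prod_def cinner_scaleC_left distrib_left)
  show "inner x y = Re (cinner x y)"
    by (simp add: cinner_prod_def inner_prod_def inner_eq_Re_cinner)
qed

end

instance prod :: (chilbert_space, chilbert_space) chilbert_space ..


section \<open>Unbounded operators\<close>

text \<open>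
  An operator is a domain together with a map whose values outside the domain are irrelevant;
  every notion below only refers to the values on the domain.
\<close>

datatype 'a lin_op = Lin_Op (dom_op: "'a set") (app: "'a \<Rightarrow> 'a")

definition linear_op :: "'a::complex_inner lin_op \<Rightarrow> bool"
  where "linear_op T \<longleftrightarrow> csubspace (dom_op T) \<and>
    (\<forall>x\<in>dom_op T. \<forall>y\<in>dom_op T. app T (x + y) = app T x + app T y) \<and>
    (\<forall>c. \<forall>x\<in>dom_op T. app T (c *\<^sub>C x) = c *\<^sub>C app T x)"

definition densely_defined :: "'a::complex_inner lin_op \<Rightarrow> bool"
  where "densely_defined T \<longleftrightarrow> closure (dom_op T) = UNIV"

definition closed_op :: "'a::complex_inner lin_op \<Rightarrow> bool"
  where "closed_op T \<longleftrightarrow> closed ((\<lambda>x. (x, app T x)) ` dom_op T)"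

definition symmetric_op :: "'a::complex_inner lin_op \<Rightarrow> bool"
  where "symmetric_op T \<longleftrightarrow> linear_op T \<and> densely_defined T \<and>
    (\<forall>x\<in>dom_op T. \<forall>y\<in>dom_op T. cinner (app T x) y = cinner x (app T y))"

text \<open>The value \<open>z\<close> below is unique if \<open>T\<close> is densely defined.\<close>

definition adjoint_op :: "'a::complex_inner lin_op \<Rightarrow> 'a lin_op"
  where "adjoint_op T = Lin_Op
    {y. \<exists>z. \<forall>x\<in>dom_op T. cinner (app T x) y = cinner x z}
    (\<lambda>y. THE z. \<forall>x\<in>dom_op T. cinner (app T x) y = cinner x z)"

definition shift_op :: "'a::complex_inner lin_op \<Rightarrow> complex \<Rightarrow> 'a lin_op"
  where "shift_op T \<mu> = Lin_Op (dom_op T) (\<lambda>x. app T x - \<mu> *\<^sub>C x)"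

definition comp_op :: "'a lin_op \<Rightarrow> 'a lin_op \<Rightarrow> 'a lin_op"
  where "comp_op S T = Lin_Op {x \<in> dom_op T. app T x \<in> dom_op S} (app S \<circ> app T)"

primrec power_op :: "'a lin_op \<Rightarrow> nat \<Rightarrow> 'a lin_op"
  where
    "power_op T 0 = Lin_Op UNIV id"
  | "power_op T (Suc k) = comp_op (power_op T k) T"

definition ker_op :: "'a::zero lin_op \<Rightarrow> 'a set"
  where "ker_op T = {x \<in> dom_op T. app T x = 0}"

definition restrict_op :: "'a lin_op \<Rightarrow> 'a set \<Rightarrow> 'a lin_op"
  where "restrict_op T U = Lin_Op (dom_op T \<inter> U) (app T)"

definition invariant_op :: "'a lin_op \<Rightarrow> 'a set \<Rightarrow> bool"
  where "invariant_op T U \<longleftrightarrow> app T ` (U \<inter> dom_op T) \<subseteq> U"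

definition point_spectrum :: "'a::complex_inner lin_op \<Rightarrow> complex set"
  where "point_spectrum T = {\<mu>. \<exists>x\<in>dom_op T. x \<noteq> 0 \<and> app T x = \<mu> *\<^sub>C x}"

definition imag_point_spectrum :: "'a::complex_inner lin_op \<Rightarrow> complex set"
  where "imag_point_spectrum T = point_spectrum T \<inter> {\<mu>. Re \<mu> = 0}"

definition root_subspace :: "'a::complex_inner lin_op \<Rightarrow> complex \<Rightarrow> 'a set"
  where "root_subspace T \<mu> = (\<Union>k. ker_op (power_op (shift_op T \<mu>) k))"

text \<open>
  Resolvent set and spectrum of an operator \<open>S\<close> acting in the Hilbert space \<open>W\<close>,
  a closed subspace of the whole type with \<open>dom_op S \<subseteq> W\<close> and values in \<open>W\<close>:
  \<open>S - \<mu>\<close> is a bijection from its domain onto \<open>W\<close> with bounded inverse.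
\<close>

definition resolvent_set_on :: "'a::complex_inner set \<Rightarrow> 'a lin_op \<Rightarrow> complex set"
  where "resolvent_set_on W S = {\<mu>. bij_betw (app (shift_op S \<mu>)) (dom_op S) W \<and>
    (\<exists>K. \<forall>x\<in>dom_op S. norm x \<le> K * norm (app (shift_op S \<mu>) x))}"

definition spectrum_on :: "'a::complex_inner set \<Rightarrow> 'a lin_op \<Rightarrow> complex set"
  where "spectrum_on W S = - resolvent_set_on W S"


section \<open>Riesz bases of subspaces\<close>

definition hilbert_isomorphism :: "('a::complex_inner \<Rightarrow> 'a) \<Rightarrow> bool"
  where "hilbert_isomorphism \<Phi> \<longleftrightarrow> Vector_Spaces.linear scaleC scaleC \<Phi> \<and> bij \<Phi> \<and>
    bounded_linear \<Phi> \<and> bounded_linear (inv \<Phi>)"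

text \<open>The algebraic sum of a family of subspaces is the linear span of their union.\<close>

definition subspace_sum :: "('i \<Rightarrow> 'a::complex_inner set) \<Rightarrow> 'a set"
  where "subspace_sum W = cspan (\<Union>k. W k)"

definition riesz_basis_of_subspaces :: "(nat \<Rightarrow> 'a::complex_inner set) \<Rightarrow> bool"
  where "riesz_basis_of_subspaces V \<longleftrightarrow>
    (\<forall>k. csubspace (V k) \<and> closed (V k)) \<and>
    (\<exists>\<Phi>. hilbert_isomorphism \<Phi> \<and>
      (\<forall>j k. j \<noteq> k \<longrightarrow> (\<forall>x\<in>\<Phi> ` V j. \<forall>y\<in>\<Phi> ` V k. cinner x y = 0)) \<and>
      closure (subspace_sum (\<lambda>k. \<Phi> ` V k)) = UNIV)"

definition compatible_subspace :: "(nat \<Rightarrow> 'a::complex_inner set) \<Rightarrow> 'a set \<Rightarrow> bool"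
  where "compatible_subspace V U \<longleftrightarrow>
    (\<exists>W. (\<forall>k. csubspace (W k) \<and> closed (W k) \<and> W k \<subseteq> V k) \<and> U = closure (subspace_sum W))"

definition finite_dimensional :: "'a::complex_inner set \<Rightarrow> bool"
  where "finite_dimensional W \<longleftrightarrow> (\<exists>F. finite F \<and> W = cspan F)"

definition core_op :: "'a::complex_inner lin_op \<Rightarrow> 'a set \<Rightarrow> bool"
  where "core_op T D \<longleftrightarrow> D \<subseteq> dom_op T \<and>
    (\<forall>x\<in>dom_op T. \<exists>u :: nat \<Rightarrow> 'a. (\<forall>n. u n \<in> D) \<and> u \<longlonglongrightarrow> x \<and> (\<lambda>n. app T (u n)) \<longlonglongrightarrow> app T x)"

definition finitely_spectral :: "'a::complex_inner lin_op \<Rightarrow> (nat \<Rightarrow> 'a set) \<Rightarrow> bool"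
  where "finitely_spectral T V \<longleftrightarrow> riesz_basis_of_subspaces V \<and>
    (\<forall>k. finite_dimensional (V k) \<and> V k \<subseteq> dom_op T \<and> invariant_op T (V k)) \<and>
    (\<forall>j k. j \<noteq> k \<longrightarrow>
      spectrum_on (V j) (restrict_op T (V j)) \<inter> spectrum_on (V k) (restrict_op T (V k)) = {}) \<and>
    core_op T (subspace_sum V)"


section \<open>Hamiltonian operator matrices and neutral subspaces\<close>

definition hamiltonian_matrix ::
    "'h::complex_inner lin_op \<Rightarrow> 'h lin_op \<Rightarrow> 'h lin_op \<Rightarrow> ('h \<times> 'h) lin_op"
  where "hamiltonian_matrix A B C = Lin_Op
    ((dom_op A \<inter> dom_op C) \<times> (dom_op (adjoint_op A) \<inter> dom_op B))
    (\<lambda>(x, y). (app A x + app B y, app C x - app (adjoint_op A) y))"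

definition hamiltonian :: "('h::complex_inner \<times> 'h) lin_op \<Rightarrow> bool"
  where "hamiltonian T \<longleftrightarrow> (\<exists>A B C. linear_op A \<and> densely_defined A \<and>
    symmetric_op B \<and> symmetric_op C \<and> T = hamiltonian_matrix A B C \<and> densely_defined T)"

definition J1 :: "'h::complex_inner \<times> 'h \<Rightarrow> 'h \<times> 'h"
  where "J1 = (\<lambda>(x, y). ((- \<i>) *\<^sub>C y, \<i> *\<^sub>C x))"

definition J1_form :: "'h::complex_inner \<times> 'h \<Rightarrow> 'h \<times> 'h \<Rightarrow> complex"
  where "J1_form x y = cinner (J1 x) y"

definition J1_orth :: "('h::complex_inner \<times> 'h) set \<Rightarrow> ('h \<times> 'h) set"
  where "J1_orth U = {x. \<forall>y\<in>U. J1_form x y = 0}"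

definition J1_neutral :: "('h::complex_inner \<times> 'h) set \<Rightarrow> bool"
  where "J1_neutral U \<longleftrightarrow> csubspace U \<and> (\<forall>x\<in>U. J1_form x x = 0)"

definition hypermaximal_J1_neutral :: "('h::complex_inner \<times> 'h) set \<Rightarrow> bool"
  where "hypermaximal_J1_neutral U \<longleftrightarrow> csubspace U \<and> U = J1_orth U"

definition sc_set :: "'a::complex_inner lin_op \<Rightarrow> complex set \<Rightarrow> bool"
  where "sc_set T \<sigma> \<longleftrightarrow> \<sigma> \<subseteq> point_spectrum T - {\<mu>. Re \<mu> = 0} \<and>
    (\<forall>\<mu>\<in>\<sigma>. - cnj \<mu> \<notin> \<sigma>) \<and>
    (\<forall>\<mu>\<in>point_spectrum T - {\<mu>. Re \<mu> = 0}. \<mu> \<in> \<sigma> \<or> - cnj \<mu> \<in> \<sigma>)"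

definition direct_sum_of :: "'a::complex_inner set \<Rightarrow> 'a set \<Rightarrow> 'a set \<Rightarrow> bool"
  where "direct_sum_of L M N \<longleftrightarrow> csubspace M \<and> csubspace N \<and> M \<inter> N = {0} \<and>
    L = {m + n | m n. m \<in> M \<and> n \<in> N}"

definition neutral_decomposition ::
    "('h::complex_inner \<times> 'h) lin_op \<Rightarrow> complex \<Rightarrow> ('h \<times> 'h) set \<Rightarrow> ('h \<times> 'h) set \<Rightarrow> bool"
  where "neutral_decomposition T \<mu> M N \<longleftrightarrow> direct_sum_of (root_subspace T \<mu>) M N \<and>
    J1_neutral M \<and> J1_neutral N \<and> invariant_op T M"

end

theory Submission
  imports Defs "HOL-Computational_Algebra.Fundamental_Theorem_Algebra"
begin

text \<open>
  The projections \<open>P k\<close> of the Riesz basis commute with \<open>T\<close>, so the disjointness of the spectra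
  puts each root subspace into a single \<open>V k\<close>, and each \<open>V k\<close> is the direct sum of the
  root subspaces it contains. Skew-symmetry of \<open>T\<close> with respect to \<open>\<langle>\<cdot>|\<cdot>\<rangle>\<close> makes the root subspaces of
  \<open>\<mu>\<close> and \<open>\<nu>\<close> orthogonal unless \<open>\<nu> = - cnj \<mu>\<close>, hence the form is a nondegenerate pairing of
  the root subspaces of \<open>\<mu>\<close> and \<open>- cnj \<mu>\<close>. Testing the components of a vector orthogonal to the
  constructed \<open>U\<close> against these pairings shows that they all lie in \<open>U\<close>. Conversely, the part of a given
  \<open>U\<close> in the root subspace of \<open>\<i>t\<close> is its own orthogonal complement there, and such a subspace of a
  finite-dimensional nondegenerate space has a neutral complement.
\<close>


section \<open>Complex inner product spaces\<close>

text \<open>Neutrality of \<open>U\<close> can be checked on its generators; the burden is to show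
  that every vector orthogonal to \<open>U\<close> lies in \<open>U\<close>. The partner eigenvalue
  \<open>- cnj \<mu>\<close> may sit in a different \<open>V j\<close>, so the form can vanish
  identically on a single \<open>V k\<close>. The argument therefore works with root subspaces, and
  nondegeneracy comes from the density of their span in the whole space. The complement
  \<open>N\<close> does not enter \<open>U\<close>: it forces a root vector orthogonal to
  \<open>M\<close> to have no part outside \<open>M\<close>. Conversely, an arbitrary complement of
  \<open>M\<close> need not be neutral; it has to be corrected, vector by vector, by elements of
  \<open>M\<close>, and this is where the hyperbolic pairs come from.\<close>

lemma cinner_add_right: "cinner x (y + z) = cinner x y + cinner x z"
  by (metis cinner_add_left cinner_commute complex_cnj_add)

lemma cinner_scaleC_right: "cinner x (c *\<^sub>C y) = cnj c * cinner x y"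
  by (metis cinner_commute cinner_scaleC_left complex_cnj_mult)

lemma cinner_zero_left [simp]: "cinner 0 x = 0"
  using cinner_scaleC_left[of 0 0 x] by simp

lemma cinner_zero_right [simp]: "cinner x 0 = 0"
  using cinner_scaleC_right[of x 0 0] by simp

lemma cinner_minus_left: "cinner (- x) y = - cinner x y"
  using cinner_add_left[of x "- x" y] by (simp add: add_eq_0_iff2 minus_equation_iff)

lemma cinner_diff_left: "cinner (x - y) z = cinner x z - cinner y z"
  using cinner_add_left[of "x - y" y z] by simp

lemma cinner_diff_right: "cinner x (y - z) = cinner x y - cinner x z"
  using cinner_add_right[of x "y - z" z] by simp

lemma cinner_eq_zero_iff: "cinner x x = 0 \<longleftrightarrow> x = 0"
  using inner_eq_Re_cinner[of x x] by auto

text \<open>With \<open>inner_eq_Re_cinner\<close>, both parts of the scalar product become real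
  inner products, so its continuity is inherited from \<open>inner\<close>.\<close>

lemma Im_cinner: "Im (cinner x y) = inner ((- \<i>) *\<^sub>C x) y"
  by (simp only: inner_eq_Re_cinner cinner_scaleC_left) simp

lemma norm_scaleC: "norm (c *\<^sub>C x) = cmod c * norm x"
proof -
  have "inner (c *\<^sub>C x) (c *\<^sub>C x) = (cmod c)\<^sup>2 * inner x x"
  proof -
    have "cinner (c *\<^sub>C x) (c *\<^sub>C x) = complex_of_real ((cmod c)\<^sup>2) * cinner x x"
      by (simp add: cinner_scaleC_left cinner_scaleC_right complex_norm_square del: of_real_power)
    then show ?thesis
      by (simp add: inner_eq_Re_cinner del: of_real_power)
  qed
  then have "(norm (c *\<^sub>C x))\<^sup>2 = (cmod c * norm x)\<^sup>2"
    by (simp add: power2_norm_eq_inner power_mult_distrib)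
  then show ?thesis
    by (simp add: power2_eq_iff_nonneg)
qed

lemma bounded_linear_scaleC: "bounded_linear (\<lambda>x. c *\<^sub>C x)"
proof (rule bounded_linear_intro[where K = "cmod c"])
  show "c *\<^sub>C (r *\<^sub>R x) = r *\<^sub>R (c *\<^sub>C x)" for r x
    by (simp add: scaleR_scaleC scaleC_scaleC mult.commute)
qed (auto simp: scaleC_add_right norm_scaleC mult.commute)

lemma tendsto_scaleC: "(f \<longlongrightarrow> l) F \<Longrightarrow> ((\<lambda>x. c *\<^sub>C f x) \<longlongrightarrow> c *\<^sub>C l) F"
  by (rule bounded_linear.tendsto[OF bounded_linear_scaleC])

lemma tendsto_cinner_left:
  assumes "(f \<longlongrightarrow> l) F"
  shows "((\<lambda>x. cinner (f x) y) \<longlongrightarrow> cinner l y) F"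
proof -
  have "((\<lambda>x. Complex (inner (f x) y) (inner ((- \<i>) *\<^sub>C f x) y)) \<longlongrightarrow>
      Complex (inner l y) (inner ((- \<i>) *\<^sub>C l) y)) F"
    by (intro tendsto_intros tendsto_Complex tendsto_scaleC assms)
  moreover have "cinner x y = Complex (inner x y) (inner ((- \<i>) *\<^sub>C x) y)" for x
    by (rule complex_eqI) (simp_all only: complex.sel inner_eq_Re_cinner Im_cinner)
  ultimately show ?thesis
    by (simp only:)
qed

lemma csubspace_closure:
  fixes S :: "'a::complex_inner set"
  assumes "csubspace S"
  shows "csubspace (closure S)"
proof (rule complex_vector.subspaceI)
  show "0 \<in> closure S"
    using assms closure_subset complex_vector.subspace_0 by blast
next
  fix x y assume "x \<in> closure S" "y \<in> closure S"
  then obtain f g where "\<forall>n. f n \<in> S" "f \<longlonglongrightarrow> x" "\<forall>n. g n \<in> S" "g \<longlonglongrightarrow> y"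
    unfolding closure_sequential by blast
  then show "x + y \<in> closure S"
    unfolding closure_sequential
    by (intro exI[of _ "\<lambda>n. f n + g n"])
      (auto intro: tendsto_add complex_vector.subspace_add[OF assms])
next
  fix c and x assume "x \<in> closure S"
  then obtain f where "\<forall>n. f n \<in> S" "f \<longlonglongrightarrow> x"
    unfolding closure_sequential by blast
  then show "c *\<^sub>C x \<in> closure S"
    unfolding closure_sequential
    by (intro exI[of _ "\<lambda>n. c *\<^sub>C f n"])
      (auto intro: tendsto_scaleC complex_vector.subspace_scale[OF assms])
qed

section \<open>Finite-dimensional subspaces and finite sums from a family of subspaces\<close>

lemma finite_dimensional_csubspace:
  fixes L :: "'a::complex_inner set"
  assumes "csubspace L" "finite_dimensional V" "L \<subseteq> V"
  shows "finite_dimensional L"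
proof -
  obtain F where F: "finite F" "V = cspan F"
    using assms(2) unfolding finite_dimensional_def by blast
  obtain B where B: "B \<subseteq> L" "complex_vector.independent B" "L \<subseteq> cspan B"
    by (rule complex_vector.maximal_independent_subset[of L])
  have "finite B"
    using complex_vector.independent_span_bound[OF F(1) B(2)] B(1) F(2) assms(3) by blast
  moreover have "L = cspan B"
    using B assms(1) complex_vector.span_minimal by blast
  ultimately show ?thesis
    unfolding finite_dimensional_def by blast
qed

lemma cspan_Union_subspaces_sum:
  fixes L :: "'i \<Rightarrow> 'a::complex_inner set"
  assumes sub: "\<And>i. i \<in> I \<Longrightarrow> csubspace (L i)" and "x \<in> cspan (\<Union>i\<in>I. L i)"
  obtains A g where "finite A" "A \<subseteq> I" "\<And>i. i \<in> A \<Longrightarrow> g i \<in> L i" "x = (\<Sum>i\<in>A. g i)"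
proof -
  have "\<exists>A g. finite A \<and> A \<subseteq> I \<and> (\<forall>i\<in>A. g i \<in> L i) \<and> x = (\<Sum>i\<in>A. g i)"
    using assms(2)
  proof (induction rule: complex_vector.span_induct_alt)
    case base
    show ?case by (intro exI[of _ "{}"]) auto
  next
    case (step c y z)
    then obtain A g where Ag: "finite A" "A \<subseteq> I" "\<forall>i\<in>A. g i \<in> L i" "z = (\<Sum>i\<in>A. g i)"
      by blast
    from step obtain j where j: "j \<in> I" "y \<in> L j" by blast
    \<comment> \<open>The index \<open>j\<close> may already occur in \<open>A\<close>; the new term
      is then added to the existing component, so that each index keeps a single vector. The guards
      with default 0 treat both cases at once.\<close>
    define h where "h i = (if i = j then c *\<^sub>C y else 0) + (if i \<in> A then g i else 0)" for i
    have "h i \<in> L i" if "i \<in> insert j A" for i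
      using that Ag j sub unfolding h_def
      by (auto intro!: complex_vector.subspace_add complex_vector.subspace_scale
          intro: complex_vector.subspace_0)
    moreover have "(\<Sum>i\<in>insert j A. h i) = c *\<^sub>C y + z"
    proof -
      have "(\<Sum>i\<in>insert j A. if i \<in> A then g i else 0) = (\<Sum>i\<in>A. g i)"
        using Ag(1) by (intro sum.mono_neutral_cong_right) auto
      then show ?thesis
        using Ag unfolding h_def by (simp add: sum.distrib sum.delta)
    qed
    ultimately show ?case
      using Ag j by (intro exI[of _ "insert j A"] exI[of _ h]) auto
  qed
  then show ?thesis
    using that by blast
qed


section \<open>Primary decomposition\<close>

lemma csubspace_incseq_Union:
  fixes R :: "nat \<Rightarrow> 'a::complex_inner set"
  assumes sub: "\<And>m. csubspace (R m)" and mono: "\<And>m. R m \<subseteq> R (Suc m)"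
  shows "csubspace (\<Union>m. R m)"
proof (rule complex_vector.subspaceI)
  show "0 \<in> (\<Union>m. R m)"
    using complex_vector.subspace_0[OF sub] by blast
next
  fix u v assume "u \<in> (\<Union>m. R m)" "v \<in> (\<Union>m. R m)"
  then obtain m n where "u \<in> R m" "v \<in> R n" by blast
  moreover have "R m \<subseteq> R (max m n)" "R n \<subseteq> R (max m n)"
    by (rule lift_Suc_mono_le[of R]; simp add: mono)+
  ultimately have "u + v \<in> R (max m n)"
    by (intro complex_vector.subspace_add[OF sub]) auto
  then show "u + v \<in> (\<Union>m. R m)" by blast
next
  fix c u assume "u \<in> (\<Union>m. R m)"
  then show "c *\<^sub>C u \<in> (\<Union>m. R m)"
    using complex_vector.subspace_scale[OF sub] by blast
qed

text \<open>On a root vector, (f - \<nu>) y = (\<mu> - \<nu>) y + (f - \<mu>) y, and the last term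
  lies one stage lower, where it is (f - \<nu>) z by induction. Hence (f - \<nu>)(y - z) = (\<mu> -
  \<nu>) y, and dividing by \<mu> - \<nu> solves the equation. The chain \<open>R\<close> is
  abstract and its recursion is required on \<open>W\<close> only, which suits a partially defined
  operator.\<close>

lemma resolvent_step_in_root_chain:
  fixes f :: "'a::complex_inner \<Rightarrow> 'a" and R :: "nat \<Rightarrow> 'a set"
  assumes W: "csubspace W" "\<And>x. x \<in> W \<Longrightarrow> f x \<in> W"
    and add: "\<And>x y. x \<in> W \<Longrightarrow> y \<in> W \<Longrightarrow> f (x + y) = f x + f y"
    and scale: "\<And>c x. x \<in> W \<Longrightarrow> f (c *\<^sub>C x) = c *\<^sub>C f x"
    and R0: "R 0 = {0}"
    and RSuc: "\<And>m x. x \<in> W \<Longrightarrow> x \<in> R (Suc m) \<longleftrightarrow> f x - \<mu> *\<^sub>C x \<in> R m"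
    and Rsub: "\<And>m. csubspace (R m)"
    and Rmono: "\<And>m. R m \<subseteq> R (Suc m)"
    and "\<mu> \<noteq> \<nu>" "y \<in> W" "y \<in> R m"
  shows "\<exists>z\<in>W \<inter> R m. f z - \<nu> *\<^sub>C z = y"
  using \<open>y \<in> W\<close> \<open>y \<in> R m\<close>
proof (induction m arbitrary: y)
  case 0
  have "f 0 = 0"
    using scale[of 0 0] complex_vector.subspace_0[OF W(1)] by simp
  then show ?case
    using 0 R0 W(1) complex_vector.subspace_0 by (intro bexI[of _ 0]) auto
next
  case (Suc m)
  note [intro] = complex_vector.subspace_diff complex_vector.subspace_scale
  define d where "d = inverse (\<mu> - \<nu>)"
  have d: "d * (\<mu> - \<nu>) = 1"
    using \<open>\<mu> \<noteq> \<nu>\<close> by (simp add: d_def)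
  have "f y - \<mu> *\<^sub>C y \<in> W"
    using Suc.prems W by blast
  moreover have "f y - \<mu> *\<^sub>C y \<in> R m"
    using Suc.prems RSuc by blast
  ultimately obtain z where z: "z \<in> W" "z \<in> R m" "f z - \<nu> *\<^sub>C z = f y - \<mu> *\<^sub>C y"
    using Suc.IH by blast
  have yz: "y - z \<in> W" "y - z \<in> R (Suc m)"
    using z Suc.prems W(1) Rsub Rmono by blast+
  have f_diff: "f (y - z) = f y - f z"
    using add[of "y - z" z] yz z by simp
  have "f (y - z) - \<nu> *\<^sub>C (y - z) = (\<mu> - \<nu>) *\<^sub>C y"
  proof -
    have "f (y - z) - \<nu> *\<^sub>C (y - z) = f y - \<nu> *\<^sub>C y - (f z - \<nu> *\<^sub>C z)"
      by (simp add: f_diff complex_vector.scale_right_diff_distrib)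
    then show ?thesis
      by (simp add: z(3) complex_vector.scale_left_diff_distrib)
  qed
  then have "f (d *\<^sub>C (y - z)) - \<nu> *\<^sub>C d *\<^sub>C (y - z) = y"
    using scale[OF yz(1), of d] d
    by (metis complex_vector.scale_left_commute complex_vector.scale_right_diff_distrib
        scaleC_one scaleC_scaleC)
  then show ?case
    using yz W(1) Rsub by (intro bexI[of _ "d *\<^sub>C (y - z)"]) auto
qed

text \<open>The vector p(f) x, by Horner recursion with \<open>f\<close> applied to the argument. In
  this form the calculation rules hold for an arbitrary map; linearity of \<open>f\<close>,
  available only on \<open>W\<close>, first enters in \<open>poly_map_linear_on\<close>.\<close>

definition poly_map :: "('a::complex_inner \<Rightarrow> 'a) \<Rightarrow> complex poly \<Rightarrow> 'a \<Rightarrow> 'a"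
  where "poly_map f p = fold_coeffs (\<lambda>a g x. a *\<^sub>C x + g (f x)) p (\<lambda>_. 0)"

lemma poly_map_0 [simp]: "poly_map f 0 x = 0"
  by (simp add: poly_map_def)

lemma poly_map_pCons [simp]: "poly_map f (pCons a p) x = a *\<^sub>C x + poly_map f p (f x)"
  by (cases "a = 0 \<and> p = 0") (auto simp: poly_map_def)

lemma poly_map_add: "poly_map f (p + q) x = poly_map f p x + poly_map f q x"
  by (induction p q arbitrary: x rule: poly_induct2)
    (simp_all add: scaleC_add_left algebra_simps)

lemma poly_map_smult: "poly_map f (smult c p) x = c *\<^sub>C poly_map f p x"
  by (induction p arbitrary: x) (simp_all add: scaleC_add_right scaleC_scaleC)

lemma poly_map_monom: "poly_map f (monom c n) x = c *\<^sub>C (f ^^ n) x"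
  by (induction n arbitrary: x)
    (simp_all add: monom_0 monom_Suc funpow_swap1)

lemma poly_map_sum: "poly_map f (\<Sum>i\<in>A. p i) x = (\<Sum>i\<in>A. poly_map f (p i) x)"
  by (induction A rule: infinite_finite_induct) (simp_all add: poly_map_add)

lemma poly_map_linear_on:
  assumes W: "csubspace W" "\<And>x. x \<in> W \<Longrightarrow> f x \<in> W"
    and add: "\<And>x y. x \<in> W \<Longrightarrow> y \<in> W \<Longrightarrow> f (x + y) = f x + f y"
    and scale: "\<And>c x. x \<in> W \<Longrightarrow> f (c *\<^sub>C x) = c *\<^sub>C f x"
  shows "x \<in> W \<Longrightarrow> y \<in> W \<Longrightarrow> poly_map f p (x + c *\<^sub>C y) = poly_map f p x + c *\<^sub>C poly_map f p y"
proof (induction p arbitrary: x y)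
  case (pCons a p)
  have "c *\<^sub>C y \<in> W"
    using pCons.prems W(1) complex_vector.subspace_scale by blast
  then show ?case
    using pCons W add scale
    by (simp add: scaleC_add_right scaleC_scaleC mult.commute algebra_simps)
qed simp

text \<open>The orbit of \<open>x\<close> under \<open>f\<close> stays in a finite-dimensional
  space. Linear dependence is a property of sets and does not see repeated vectors, so a coincidence
  of two iterates is treated separately, by a difference of monomials; otherwise the orbit is
  infinite, hence dependent.\<close>

lemma annihilating_poly_exists:
  fixes f :: "'a::complex_inner \<Rightarrow> 'a"
  assumes V: "finite_dimensional V" and W: "W \<subseteq> V" "\<And>x. x \<in> W \<Longrightarrow> f x \<in> W" and "x \<in> W"
  obtains p where "p \<noteq> 0" "poly_map f p x = 0"
proof -
  define g where "g n = (f ^^ n) x" for n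
  have g: "g n \<in> V" for n
  proof -
    have "g n \<in> W"
      using W \<open>x \<in> W\<close> by (induction n) (auto simp: g_def)
    then show ?thesis
      using W(1) by blast
  qed
  show ?thesis
  proof (cases "inj g")
    case False
    then obtain m n where mn: "m \<noteq> n" "g m = g n"
      by (auto simp: inj_def)
    have "coeff (monom 1 m - monom (1::complex) n) m \<noteq> 0"
      using mn by simp
    then have "monom 1 m + smult (-1) (monom (1::complex) n) \<noteq> 0"
      by (metis coeff_0 diff_conv_add_uminus smult_1_left smult_minus_left)
    moreover have "poly_map f (monom 1 m + smult (-1) (monom 1 n)) x = 0"
      using mn(2) by (simp only: poly_map_add poly_map_smult poly_map_monom)
        (simp add: g_def scaleC_one)
    ultimately show ?thesis
      using that by blast
  next
    case True
    obtain F where F: "finite F" "V = cspan F"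
      using V unfolding finite_dimensional_def by blast
    have "complex_vector.dependent (range g)"
      using complex_vector.independent_span_bound[OF F(1), of "range g"] g F(2)
        range_inj_infinite[OF True] by blast
    then obtain S u v where S: "finite S" "S \<subseteq> range g" "(\<Sum>v\<in>S. u v *\<^sub>C v) = 0"
      "v \<in> S" "u v \<noteq> 0"
      unfolding complex_vector.dependent_explicit by blast
    define I where "I = g -` S"
    have I: "finite I" "g ` I = S"
      using S True unfolding I_def by (auto intro: finite_vimageI)
    define p where "p = (\<Sum>i\<in>I. monom (u (g i)) i)"
    obtain i where i: "i \<in> I" "v = g i"
      using S I by blast
    have "coeff p i = u v"
      using i I(1) by (simp add: p_def coeff_sum)
    then have "p \<noteq> 0"
      using S by auto
    have "poly_map f p x = (\<Sum>i\<in>I. u (g i) *\<^sub>C g i)"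
      by (simp add: p_def poly_map_sum poly_map_monom g_def)
    also have "\<dots> = 0"
      using S(3) sum.reindex[OF inj_on_subset[OF True subset_UNIV[of I]], of "\<lambda>v. u v *\<^sub>C v"]
      by (simp add: I(2) o_def)
    finally show ?thesis
      using that \<open>p \<noteq> 0\<close> by blast
  qed
qed

text \<open>
  Induction on the degree of an annihilating polynomial: splitting off a root \<open>\<nu>\<close>, the
  components of \<open>f x - \<nu> x\<close> for \<open>\<mu> \<noteq> \<nu>\<close> can be divided by \<open>f - \<nu>\<close> inside
  their root subspaces, and what remains of \<open>x\<close> is a root vector for \<open>\<nu>\<close>.
\<close>

lemma primary_decomposition:
  fixes f :: "'a::complex_inner \<Rightarrow> 'a" and R :: "complex \<Rightarrow> nat \<Rightarrow> 'a set"
  assumes W: "csubspace W" "\<And>x. x \<in> W \<Longrightarrow> f x \<in> W"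
    and add: "\<And>x y. x \<in> W \<Longrightarrow> y \<in> W \<Longrightarrow> f (x + y) = f x + f y"
    and scale: "\<And>c x. x \<in> W \<Longrightarrow> f (c *\<^sub>C x) = c *\<^sub>C f x"
    and R0: "\<And>\<mu>. R \<mu> 0 = {0}"
    and RSuc: "\<And>\<mu> m x. x \<in> W \<Longrightarrow> x \<in> R \<mu> (Suc m) \<longleftrightarrow> f x - \<mu> *\<^sub>C x \<in> R \<mu> m"
    and Rsub: "\<And>\<mu> m. csubspace (R \<mu> m)"
    and Rmono: "\<And>\<mu> m. R \<mu> m \<subseteq> R \<mu> (Suc m)"
    and "p \<noteq> 0" "x \<in> W" "poly_map f p x = 0"
  shows "x \<in> cspan (\<Union>\<mu>. W \<inter> (\<Union>m. R \<mu> m))"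
  using assms(9-11)
proof (induction "degree p" arbitrary: p x)
  case 0
  then obtain a where "p = [:a:]" "a \<noteq> 0"
    by (metis degree_eq_zeroE pCons_eq_0_iff)
  then have "x = 0"
    using 0 by simp
  then show ?case
    by (simp add: complex_vector.span_zero)
next
  case (Suc n)
  let ?G = "\<Union>\<mu>. W \<inter> (\<Union>m. R \<mu> m)"
  have "\<not> constant (poly p)"
    using Suc.hyps by (simp add: constant_degree)
  then obtain \<nu> where "poly p \<nu> = 0"
    using fundamental_theorem_of_algebra by blast
  then obtain q where q: "p = [:-\<nu>, 1:] * q"
    by (metis poly_eq_0_iff_dvd dvdE)
  then have q0: "q \<noteq> 0"
    using Suc.prems(1) by auto
  have "degree p = Suc (degree q)"
    unfolding q using q0 by (subst degree_mult_eq) auto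
  then have deg: "degree q = n"
    using Suc.hyps(2) by simp
  \<comment> \<open>Since p = (X - \<nu>) q, the polynomial \<open>q\<close> of smaller degree
    annihilates \<open>?y\<close>, though not necessarily \<open>x\<close>; the induction hypothesis
    is applied to \<open>?y\<close>.\<close>
  let ?y = "f x + (- \<nu>) *\<^sub>C x"
  have y: "?y \<in> W"
    using W \<open>x \<in> W\<close> by (intro complex_vector.subspace_add complex_vector.subspace_scale) auto
  have "poly_map f p x = poly_map f q (f x) + (- \<nu>) *\<^sub>C poly_map f q x"
    by (simp add: q poly_map_add poly_map_smult del: smult_minus_left)
  also have "\<dots> = poly_map f q ?y"
    using poly_map_linear_on[where f = f and p = q, OF W add scale W(2)[OF \<open>x \<in> W\<close>] \<open>x \<in> W\<close>, of "- \<nu>"]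
    by simp
  finally have y_span: "?y \<in> cspan ?G"
    using Suc.hyps(1)[of q ?y] deg q0 y Suc.prems by simp
  have sub: "csubspace (W \<inter> (\<Union>m. R \<mu> m))" for \<mu>
  proof -
    have "csubspace (\<Union>m. R \<mu> m)"
      by (rule csubspace_incseq_Union) (rule Rsub Rmono)+
    then show ?thesis
      by (rule complex_vector.subspace_inter[OF W(1)])
  qed
  obtain A g where A: "finite A"
    "\<And>\<mu>. \<mu> \<in> A \<Longrightarrow> g \<mu> \<in> W \<inter> (\<Union>m. R \<mu> m)" "?y = (\<Sum>\<mu>\<in>A. g \<mu>)"
    using cspan_Union_subspaces_sum[OF sub y_span] by metis
  have "\<exists>z. z \<in> W \<inter> (\<Union>m. R \<mu> m) \<and> f z - \<nu> *\<^sub>C z = g \<mu>" if "\<mu> \<in> A - {\<nu>}" for \<mu>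
  proof -
    have "g \<mu> \<in> W" "\<exists>m. g \<mu> \<in> R \<mu> m"
      using A(2)[of \<mu>] that by auto
    then obtain m where "g \<mu> \<in> R \<mu> m"
      by blast
    have "\<exists>z\<in>W \<inter> R \<mu> m. f z - \<nu> *\<^sub>C z = g \<mu>"
    proof (rule resolvent_step_in_root_chain[where R = "R \<mu>" and f = f and \<mu> = \<mu>])
      show "\<mu> \<noteq> \<nu>"
        using that by blast
    qed (fact W add scale R0 RSuc Rsub Rmono \<open>g \<mu> \<in> W\<close> \<open>g \<mu> \<in> R \<mu> m\<close>)+
    then show ?thesis
      by blast
  qed
  then obtain z where z: "\<And>\<mu>. \<mu> \<in> A - {\<nu>} \<Longrightarrow> z \<mu> \<in> W \<inter> (\<Union>m. R \<mu> m)"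
    "\<And>\<mu>. \<mu> \<in> A - {\<nu>} \<Longrightarrow> f (z \<mu>) - \<nu> *\<^sub>C z \<mu> = g \<mu>"
    by metis
  define s where "s = (\<Sum>\<mu>\<in>A - {\<nu>}. z \<mu>)"
  have sums: "s \<in> W \<and> f s - \<nu> *\<^sub>C s = (\<Sum>\<mu>\<in>A - {\<nu>}. g \<mu>)"
  proof -
    have f0: "f 0 = 0"
      using scale[of 0 0] complex_vector.subspace_0[OF W(1)] by simp
    have "(\<Sum>\<mu>\<in>B. z \<mu>) \<in> W \<and> f (\<Sum>\<mu>\<in>B. z \<mu>) - \<nu> *\<^sub>C (\<Sum>\<mu>\<in>B. z \<mu>) = (\<Sum>\<mu>\<in>B. g \<mu>)"
      if "finite B" "B \<subseteq> A - {\<nu>}" for B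
      using that
    proof (induction B)
      case empty
      then show ?case
        using f0 W(1) complex_vector.subspace_0 by auto
    next
      case (insert b B)
      then have b: "z b \<in> W" "f (z b) - \<nu> *\<^sub>C z b = g b"
        using z by auto
      have IH: "sum z B \<in> W" "f (sum z B) - \<nu> *\<^sub>C sum z B = sum g B"
        using insert by auto
      have "f (z b + sum z B) - \<nu> *\<^sub>C (z b + sum z B) = g b + sum g B"
        using IH b add[OF b(1) IH(1)] by (simp add: scaleC_add_right algebra_simps flip: b(2) IH(2))
      then show ?case
        using insert b IH complex_vector.subspace_add[OF W(1)] by simp
    qed
    then show ?thesis
      using A(1) by (simp add: s_def)
  qed
  have xs: "x - s \<in> W"
    using \<open>x \<in> W\<close> sums W(1) complex_vector.subspace_diff by blast
  have "x - s \<in> (\<Union>m. R \<nu> m)"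
  proof -
    have "f (x - s) = f x - f s"
      using add[OF xs, of s] sums by simp
    then have "f (x - s) - \<nu> *\<^sub>C (x - s) = ?y - (f s - \<nu> *\<^sub>C s)"
      by (simp add: complex_vector.scale_right_diff_distrib)
    also have "\<dots> = (\<Sum>\<mu>\<in>A. g \<mu>) - (\<Sum>\<mu>\<in>A - {\<nu>}. g \<mu>)"
      using sums A(3) by simp
    \<comment> \<open>The only component not divided by f - \<nu> is the one at \<nu> itself, and it
      belongs to a root chain of \<nu>; \<open>x - s\<close> then lies one stage higher.\<close>
    also have "\<dots> = (if \<nu> \<in> A then g \<nu> else 0)"
      using A(1) by (auto simp: sum.remove)
    finally have "f (x - s) - \<nu> *\<^sub>C (x - s) \<in> (\<Union>m. R \<nu> m)"
      using A(2) R0 by auto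
    then show ?thesis
      using RSuc[OF xs] by blast
  qed
  then have "x - s \<in> cspan ?G"
    using xs by (intro complex_vector.span_base) blast
  moreover have "s \<in> cspan ?G"
    unfolding s_def using z(1) by (intro complex_vector.span_sum complex_vector.span_base) blast
  ultimately show ?case
    using complex_vector.span_add by fastforce
qed


section \<open>Hamiltonians and the indefinite form\<close>

lemma dense_cinner_right_zero:
  assumes "closure S = UNIV" "\<And>x. x \<in> S \<Longrightarrow> cinner x z = 0"
  shows "z = 0"
proof -
  obtain f where f: "\<forall>n. f n \<in> S" "f \<longlonglongrightarrow> z"
    using assms(1) unfolding set_eq_iff closure_sequential by blast
  have "(\<lambda>n. cinner (f n) z) \<longlonglongrightarrow> cinner z z"
    by (rule tendsto_cinner_left[OF f(2)])
  then have "cinner z z = 0"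
    using f(1) assms(2) by (simp add: LIMSEQ_const_iff)
  then show ?thesis
    by (simp add: cinner_eq_zero_iff)
qed

lemma dense_cinner_right_unique:
  assumes "closure S = UNIV" "\<And>x. x \<in> S \<Longrightarrow> cinner x y = cinner x z"
  shows "y = z"
  using dense_cinner_right_zero[OF assms(1), of "y - z"] assms(2) by (simp add: cinner_diff_right)

text \<open>Density of the domain resolves the definite description in \<open>adjoint_op\<close>, so
  a single candidate \<open>z\<close> yields both membership in the domain and the value.\<close>

lemma adjoint_op_eqI:
  assumes "densely_defined A" "\<And>x. x \<in> dom_op A \<Longrightarrow> cinner (app A x) y = cinner x z"
  shows "y \<in> dom_op (adjoint_op A)" "app (adjoint_op A) y = z"
proof -
  show "y \<in> dom_op (adjoint_op A)"
    using assms(2) by (auto simp: adjoint_op_def)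
  have "(THE z. \<forall>x\<in>dom_op A. cinner (app A x) y = cinner x z) = z"
  proof (rule the_equality)
    fix w assume "\<forall>x\<in>dom_op A. cinner (app A x) y = cinner x w"
    then show "w = z"
      using assms by (intro dense_cinner_right_unique[of "dom_op A"]) (auto simp: densely_defined_def)
  qed (use assms(2) in blast)
  then show "app (adjoint_op A) y = z"
    by (simp add: adjoint_op_def)
qed

lemma cinner_adjoint_op:
  assumes "densely_defined A" "x \<in> dom_op A" "y \<in> dom_op (adjoint_op A)"
  shows "cinner (app A x) y = cinner x (app (adjoint_op A) y)"
proof -
  obtain z where "\<forall>x\<in>dom_op A. cinner (app A x) y = cinner x z"
    using assms(3) by (auto simp: adjoint_op_def)
  then show ?thesis
    using adjoint_op_eqI[OF assms(1), of y z] assms(2) by simp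
qed

lemma linear_op_adjoint:
  assumes "densely_defined A"
  shows "linear_op (adjoint_op A)"
proof -
  note [simp] = cinner_adjoint_op[OF assms]
  have add: "x + y \<in> dom_op (adjoint_op A) \<and>
      app (adjoint_op A) (x + y) = app (adjoint_op A) x + app (adjoint_op A) y"
    if "x \<in> dom_op (adjoint_op A)" "y \<in> dom_op (adjoint_op A)" for x y
    using adjoint_op_eqI[OF assms, of "x + y" "app (adjoint_op A) x + app (adjoint_op A) y"] that
    by (simp add: cinner_add_right)
  have scale: "c *\<^sub>C x \<in> dom_op (adjoint_op A) \<and>
      app (adjoint_op A) (c *\<^sub>C x) = c *\<^sub>C app (adjoint_op A) x"
    if "x \<in> dom_op (adjoint_op A)" for c x
    using adjoint_op_eqI[OF assms, of "c *\<^sub>C x" "c *\<^sub>C app (adjoint_op A) x"] that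
    by (simp add: cinner_scaleC_right)
  have "0 \<in> dom_op (adjoint_op A)"
    using adjoint_op_eqI(1)[OF assms, of 0 0] by simp
  then show ?thesis
    unfolding linear_op_def complex_vector.subspace_def using add scale by blast
qed

section \<open>The indefinite form and its orthogonal complements\<close>

lemma J1_form_eq:
  "J1_form x y = \<i> * cinner (fst x) (snd y) - \<i> * cinner (snd x) (fst y)"
  by (simp add: J1_form_def J1_def cinner_prod_def cinner_scaleC_left cinner_minus_left split: prod.splits)

lemma J1_form_commute: "J1_form x y = cnj (J1_form y x)"
  unfolding J1_form_eq
  by (subst cinner_commute[of "fst x"], subst cinner_commute[of "snd x"]) simp

lemma J1_form_add_left: "J1_form (x + y) z = J1_form x z + J1_form y z"
  by (simp add: J1_form_eq cinner_add_left algebra_simps)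

lemma J1_form_add_right: "J1_form x (y + z) = J1_form x y + J1_form x z"
  by (simp add: J1_form_eq cinner_add_right algebra_simps)

lemma J1_form_scaleC_left: "J1_form (c *\<^sub>C x) y = c * J1_form x y"
  by (simp add: J1_form_eq scaleC_prod_def cinner_scaleC_left algebra_simps)

lemma J1_form_scaleC_right: "J1_form x (c *\<^sub>C y) = cnj c * J1_form x y"
  by (simp add: J1_form_eq scaleC_prod_def cinner_scaleC_right algebra_simps)

lemma J1_form_diff_left: "J1_form (x - y) z = J1_form x z - J1_form y z"
  by (simp add: J1_form_eq cinner_diff_left algebra_simps)

lemma J1_form_diff_right: "J1_form x (y - z) = J1_form x y - J1_form x z"
  by (simp add: J1_form_eq cinner_diff_right algebra_simps)

lemma J1_form_zero_left [simp]: "J1_form 0 y = 0"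
  by (simp add: J1_form_eq)

lemma J1_form_zero_right [simp]: "J1_form x 0 = 0"
  by (simp add: J1_form_eq)

lemma J1_form_zero_commute: "J1_form x y = 0 \<longleftrightarrow> J1_form y x = 0"
  using J1_form_commute[of x y] by simp

lemmas J1_form_linear = J1_form_add_left J1_form_add_right J1_form_scaleC_left
  J1_form_scaleC_right J1_form_diff_left J1_form_diff_right

lemma tendsto_J1_form_left:
  "(f \<longlongrightarrow> l) F \<Longrightarrow> ((\<lambda>x. J1_form (f x) y) \<longlongrightarrow> J1_form l y) F"
  unfolding J1_form_eq by (intro tendsto_intros tendsto_cinner_left)

lemma csubspace_J1_orth: "csubspace (J1_orth U)"
  by (auto simp: J1_orth_def complex_vector.subspace_def J1_form_linear)

lemma closed_J1_orth: "closed (J1_orth U)"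
  unfolding closed_sequential_limits
proof (intro allI impI, elim conjE)
  fix f l assume f: "\<forall>n. f n \<in> J1_orth U" "f \<longlonglongrightarrow> l"
  have "J1_form l y = 0" if "y \<in> U" for y
    using tendsto_J1_form_left[OF f(2), of y] f(1) that by (simp add: J1_orth_def LIMSEQ_const_iff)
  then show "l \<in> J1_orth U"
    by (simp add: J1_orth_def)
qed

lemma subset_J1_orth_commute: "A \<subseteq> J1_orth B \<longleftrightarrow> B \<subseteq> J1_orth A"
  using J1_form_zero_commute by (fastforce simp: J1_orth_def)

lemma closure_cspan_subset_J1_orth:
  "S \<subseteq> J1_orth U \<Longrightarrow> closure (cspan S) \<subseteq> J1_orth U"
  by (intro closure_minimal complex_vector.span_minimal csubspace_J1_orth closed_J1_orth)

text \<open>Any orthogonal complement is a closed subspace, so the double complement of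
  \<open>S\<close> contains the closed span of \<open>S\<close>; taking complements once more gives
  the nontrivial inclusion. Orthogonality may thus be tested on generators.\<close>

lemma J1_orth_closure_cspan: "J1_orth (closure (cspan S)) = J1_orth S"
proof
  have "S \<subseteq> closure (cspan S)"
    using complex_vector.span_superset closure_subset by blast
  then show "J1_orth (closure (cspan S)) \<subseteq> J1_orth S"
    by (auto simp: J1_orth_def)
  have "closure (cspan S) \<subseteq> J1_orth (J1_orth S)"
    by (intro closure_cspan_subset_J1_orth) (simp add: subset_J1_orth_commute[of S])
  then show "J1_orth S \<subseteq> J1_orth (closure (cspan S))"
    by (simp add: subset_J1_orth_commute)
qed

lemma J1_orth_dense:
  assumes "closure (cspan S) = UNIV"
  shows "J1_orth S = {0}"
proof -
  have "x = 0" if "x \<in> J1_orth S" for x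
  proof -
    have "x \<in> J1_orth UNIV"
      using that J1_orth_closure_cspan[of S] assms by simp
    \<comment> \<open>Testing with \<open>J1 x\<close> turns the form into the squared norm of
      \<open>J1 x\<close>, and \<open>J1\<close> is injective.\<close>
    then have "J1_form x (J1 x) = 0"
      unfolding J1_orth_def by blast
    then have "J1 x = 0"
      by (simp add: J1_form_def cinner_eq_zero_iff)
    then show ?thesis
      by (cases x) (simp add: J1_def zero_prod_def)
  qed
  then show ?thesis
    by (auto simp: J1_orth_def)
qed

text \<open>Polarization: \<open>\<langle>x|y\<rangle>\<close> is a combination of the values \<open>\<langle>x + c y|x + c y\<rangle>\<close> for \<open>c = 1, \<i>\<close>.\<close>

lemma J1_neutral_orth:
  assumes "J1_neutral U" "x \<in> U" "y \<in> U"
  shows "J1_form x y = 0"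
proof -
  have U: "csubspace U" "\<And>z. z \<in> U \<Longrightarrow> J1_form z z = 0"
    using assms(1) by (auto simp: J1_neutral_def)
  have "J1_form (x + c *\<^sub>C y) (x + c *\<^sub>C y) = 0" for c
    using U assms(2,3) by (intro U(2) complex_vector.subspace_add complex_vector.subspace_scale)
  then have *: "cnj c * J1_form x y + c * J1_form y x = 0" for c
    using U(2) assms(2,3) by (simp add: J1_form_linear add.commute)
  have "J1_form x y + J1_form y x = 0" "J1_form y x - J1_form x y = 0"
    using *[of 1] *[of \<i>] by (auto simp: algebra_simps)
  then show ?thesis
    by (simp add: algebra_simps)
qed

lemma hamiltonian_linear_op:
  assumes "hamiltonian T"
  shows "linear_op T"
proof -
  obtain A B C where h: "linear_op A" "densely_defined A" "symmetric_op B" "symmetric_op C"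
    and T: "T = hamiltonian_matrix A B C"
    using assms unfolding hamiltonian_def by blast
  have l: "linear_op A" "linear_op B" "linear_op C" "linear_op (adjoint_op A)"
    using h linear_op_adjoint by (auto simp: symmetric_op_def)
  have "csubspace (S \<times> S')" if "csubspace S" "csubspace S'" for S S' :: "'a set"
    using that by (auto simp: complex_vector.subspace_def scaleC_prod_def zero_prod_def)
  then have "csubspace (dom_op T)"
    using l unfolding T hamiltonian_matrix_def linear_op_def
    by (simp add: complex_vector.subspace_inter)
  then show ?thesis
    using l unfolding linear_op_def
    by (auto simp: T hamiltonian_matrix_def scaleC_prod_def
        scaleC_add_right complex_vector.scale_right_diff_distrib)
qed

text \<open>Terms with \<open>A\<close> on one side meet terms with its adjoint on the other, and
  the terms with \<open>B\<close> and \<open>C\<close> match by symmetry. In operator language, \<i>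
  J1 T is symmetric.\<close>

lemma hamiltonian_skew_symmetric:
  assumes "hamiltonian T" "x \<in> dom_op T" "y \<in> dom_op T"
  shows "J1_form (app T x) y = - J1_form x (app T y)"
proof -
  obtain A B C where h: "densely_defined A" "symmetric_op B" "symmetric_op C"
    and T: "T = hamiltonian_matrix A B C"
    using assms unfolding hamiltonian_def by blast
  obtain x1 x2 y1 y2 where xy: "x = (x1, x2)" "y = (y1, y2)"
    by (cases x, cases y)
  have d: "x1 \<in> dom_op A" "x1 \<in> dom_op C" "y1 \<in> dom_op A" "y1 \<in> dom_op C"
    "x2 \<in> dom_op (adjoint_op A)" "x2 \<in> dom_op B" "y2 \<in> dom_op (adjoint_op A)" "y2 \<in> dom_op B"
    using assms(2,3) by (auto simp: T xy hamiltonian_matrix_def)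
  have "cinner (app B x2) y2 = cinner x2 (app B y2)" "cinner (app C x1) y1 = cinner x1 (app C y1)"
    "cinner (app A x1) y2 = cinner x1 (app (adjoint_op A) y2)"
    using h d by (auto simp: symmetric_op_def cinner_adjoint_op)
  moreover have "cinner (app (adjoint_op A) x2) y1 = cinner x2 (app A y1)"
    using cinner_adjoint_op[OF h(1) d(3,5)] cinner_commute by metis
  ultimately show ?thesis
    by (simp add: T xy hamiltonian_matrix_def J1_form_eq cinner_add_left cinner_add_right
        cinner_diff_left cinner_diff_right algebra_simps)
qed


section \<open>Neutral complements\<close>

lemma csubspace_insert:
  fixes K :: "'a::complex_inner set"
  assumes "csubspace K"
  shows "csubspace {k + c *\<^sub>C u | k c. k \<in> K}"
proof (rule complex_vector.subspaceI)
  show "0 \<in> {k + c *\<^sub>C u | k c. k \<in> K}"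
    using complex_vector.subspace_0[OF assms] by (force intro: exI[of _ 0])
next
  fix x y assume "x \<in> {k + c *\<^sub>C u | k c. k \<in> K}" "y \<in> {k + c *\<^sub>C u | k c. k \<in> K}"
  then obtain k c l d where "x = k + c *\<^sub>C u" "y = l + d *\<^sub>C u" "k \<in> K" "l \<in> K" by blast
  then have "x + y = (k + l) + (c + d) *\<^sub>C u" "k + l \<in> K"
    using complex_vector.subspace_add[OF assms] by (auto simp: scaleC_add_left)
  then show "x + y \<in> {k + c *\<^sub>C u | k c. k \<in> K}" by blast
next
  fix c x assume "x \<in> {k + c *\<^sub>C u | k c. k \<in> K}"
  then obtain k d where "x = k + d *\<^sub>C u" "k \<in> K" by blast
  then have "c *\<^sub>C x = c *\<^sub>C k + (c * d) *\<^sub>C u" "c *\<^sub>C k \<in> K"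
    using complex_vector.subspace_scale[OF assms] by (auto simp: scaleC_add_right scaleC_scaleC)
  then show "c *\<^sub>C x \<in> {k + c *\<^sub>C u | k c. k \<in> K}" by blast
qed

text \<open>
  \<open>K \<subseteq> M\<close> and \<open>N\<close> are built simultaneously out of hyperbolic pairs \<open>u \<in> M\<close>, \<open>v\<close> with
  \<open>\<langle>u|v\<rangle> = 1\<close> and \<open>\<langle>v|v\<rangle> = 0\<close>, so that \<open>K + N\<close> stays an orthogonally
  complemented subspace of \<open>L\<close>, until \<open>M + N\<close> contains a prescribed finite set.
\<close>

lemma hyperbolic_extension:
  fixes L M :: "('h::complex_inner \<times> 'h) set"
  assumes L: "csubspace L" and M: "csubspace M"
    and nondeg: "L \<inter> J1_orth L = {0}" and lag: "M = L \<inter> J1_orth M"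
    and "finite F" "F \<subseteq> L"
  shows "\<exists>K N. csubspace K \<and> K \<subseteq> M \<and> J1_neutral N \<and> N \<subseteq> L \<and>
    (\<forall>y\<in>L. \<exists>k\<in>K. \<exists>n\<in>N. y - k - n \<in> J1_orth K \<inter> J1_orth N) \<and>
    (\<forall>f\<in>F. \<exists>m\<in>M. f - m \<in> N)"
  using assms(5,6)
proof (induction F)
  case empty
  show ?case
    using complex_vector.subspace_0[OF L] complex_vector.subspace_0[OF M]
    by (intro exI[of _ "{0}"]) (auto simp: J1_neutral_def J1_orth_def complex_vector.subspace_def)
next
  case (insert f F)
  then obtain K N where K: "csubspace K" "K \<subseteq> M" and N: "J1_neutral N" "N \<subseteq> L"
    and dec: "\<forall>y\<in>L. \<exists>k\<in>K. \<exists>n\<in>N. y - k - n \<in> J1_orth K \<inter> J1_orth N"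
    and F: "\<forall>f\<in>F. \<exists>m\<in>M. f - m \<in> N"
    by auto
  show ?case
  proof (cases "\<exists>m\<in>M. f - m \<in> N")
    case True
    with K N dec F show ?thesis
      by (intro exI[of _ K] exI[of _ N]) auto
  next
    case False
    have MsubL: "M \<subseteq> L" and MM: "\<And>x y. \<lbrakk>x \<in> M; y \<in> M\<rbrakk> \<Longrightarrow> J1_form x y = 0"
      using lag by (auto simp: J1_orth_def)
    have Ns: "csubspace N"
      using N(1) by (simp add: J1_neutral_def)
    obtain k n where kn: "k \<in> K" "n \<in> N" "f - k - n \<in> J1_orth K \<inter> J1_orth N"
      using dec insert.prems by blast
    \<comment> \<open>Since \<open>f\<close> is not in M + N, removing its part in K + N leaves a
      vector outside \<open>M\<close>. As \<open>M\<close> is its own complement in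
      \<open>L\<close>, this vector is not orthogonal to \<open>M\<close>, which supplies the
      partner for a new hyperbolic pair.\<close>
    define x where "x = f - k - n"
    have x: "x \<in> L" "x \<in> J1_orth K" "x \<in> J1_orth N"
      using kn K(2) N(2) MsubL insert.prems
      by (auto simp: x_def intro!: complex_vector.subspace_diff[OF L])
    have "x \<notin> M"
    proof
      assume "x \<in> M"
      then have "k + x \<in> M"
        using kn(1) K(2) complex_vector.subspace_add[OF M] by blast
      moreover have "f - (k + x) = n"
        by (simp add: x_def)
      ultimately show False
        using False kn(2) by metis
    qed
    then have "x \<notin> J1_orth M"
      using lag x(1) by blast
    then obtain m where "m \<in> M" "J1_form x m \<noteq> 0"
      unfolding J1_orth_def by blast
    then have m: "m \<in> M" "J1_form m x \<noteq> 0"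
      using J1_form_zero_commute[of m x] by simp_all
    obtain k' n' where kn': "k' \<in> K" "n' \<in> N" "m - k' - n' \<in> J1_orth K \<inter> J1_orth N"
      using dec m MsubL by blast
    \<comment> \<open>Projecting \<open>m\<close> away from K + N must not lead out of
      \<open>M\<close>, so its part \<open>n'\<close> has to vanish. It is orthogonal to
      \<open>K\<close> because \<open>m\<close>, \<open>k'\<close> and the remainder are, to
      \<open>N\<close> by neutrality, and to every remainder; nondegeneracy then gives
      \<open>n' = 0\<close>.\<close>
    have "n' \<in> J1_orth L"
      unfolding J1_orth_def
    proof (intro CollectI ballI)
      fix y assume "y \<in> L"
      then obtain l r where lr: "l \<in> K" "r \<in> N" "y - l - r \<in> J1_orth K \<inter> J1_orth N"
        using dec by blast
      have "J1_form (m - k' - n') l = 0" "J1_form m l = 0" "J1_form k' l = 0"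
        using kn' lr(1) m(1) K(2) MM unfolding J1_orth_def by blast+
      then have "J1_form n' l = 0"
        by (simp add: J1_form_linear)
      moreover have "J1_form n' r = 0"
        using J1_neutral_orth[OF N(1)] kn'(2) lr(2) by blast
      moreover have "J1_form n' (y - l - r) = 0"
        using lr(3) kn'(2) J1_form_zero_commute[of n'] by (auto simp: J1_orth_def)
      ultimately show "J1_form n' y = 0"
        by (simp add: J1_form_linear)
    qed
    then have "n' = 0"
      using nondeg kn'(2) N(2) by blast
    define u where "u = inverse (J1_form m x) *\<^sub>C (m - k')"
    have u: "u \<in> M" "u \<in> J1_orth K" "u \<in> J1_orth N"
      using kn' \<open>n' = 0\<close> m(1) K(2)
      by (auto simp: u_def intro!: complex_vector.subspace_scale complex_vector.subspace_diff M
          csubspace_J1_orth)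
    have "J1_form k' x = 0"
      using x(2) kn'(1) J1_form_zero_commute[of k'] by (simp add: J1_orth_def)
    then have ux: "J1_form u x = 1"
      using m(2) by (simp add: u_def J1_form_linear)
    then have xu: "J1_form x u = 1"
      using J1_form_commute[of x u] by simp
    have uu: "J1_form u u = 0"
      using MM u(1) by blast
    define a where "a = J1_form x x"
    have a: "cnj a = a"
      using J1_form_commute[of x x] by (simp add: a_def)
    \<comment> \<open>The coefficient \<open>a / 2\<close> makes \<open>v\<close> neutral:
      \<langle>v|v\<rangle> = a - a/2 - a/2, because \<open>a\<close> is real, \<langle>u|x\<rangle>
      = 1 and \<langle>u|u\<rangle> = 0.\<close>
    define v where "v = x - (a / 2) *\<^sub>C u"
    have v: "v \<in> L" "v \<in> J1_orth K" "v \<in> J1_orth N"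
      using x u MsubL by (auto simp: v_def
          intro!: complex_vector.subspace_scale complex_vector.subspace_diff L csubspace_J1_orth)
    have vv: "J1_form v v = 0" and uv: "J1_form u v = 1" and vu: "J1_form v u = 1"
      using ux xu uu a by (simp_all add: v_def J1_form_linear a_def[symmetric])
    have [simp]: "J1_form u l = 0" "J1_form v l = 0" "J1_form l u = 0" "J1_form l v = 0" if "l \<in> K \<union> N" for l
      using that u v J1_form_zero_commute[of l] by (auto simp: J1_orth_def)
    define K' where "K' = {k + c *\<^sub>C u | k c. k \<in> K}"
    define N' where "N' = {n + c *\<^sub>C v | n c. n \<in> N}"
    have "K \<subseteq> K'" "N \<subseteq> N'"
      by (force simp: K'_def N'_def intro: exI[of _ 0])+
    have "csubspace K'" "csubspace N'"
      unfolding K'_def N'_def by (rule csubspace_insert; fact)+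
    have "K' \<subseteq> M"
      using K(2) u(1) by (auto simp: K'_def intro!: complex_vector.subspace_add complex_vector.subspace_scale M)
    have "N' \<subseteq> L"
      using N(2) v(1) by (auto simp: N'_def intro!: complex_vector.subspace_add complex_vector.subspace_scale L)
    have "J1_form z z = 0" if "z \<in> N'" for z
      using that N(1) by (auto simp: N'_def J1_form_linear vv J1_neutral_def)
    have "\<exists>k\<in>K'. \<exists>n\<in>N'. y - k - n \<in> J1_orth K' \<inter> J1_orth N'" if "y \<in> L" for y
    proof -
      obtain l r where lr: "l \<in> K" "r \<in> N" "y - l - r \<in> J1_orth K \<inter> J1_orth N"
        using bspec[OF dec \<open>y \<in> L\<close>] by blast
      define w where "w = y - l - r"
      \<comment> \<open>In a hyperbolic pair the coefficient along \<open>u\<close> is read off with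
        \<open>v\<close> and vice versa; subtracting both parts makes the remainder orthogonal to
        the new pair as well.\<close>
      define w' where "w' = w - J1_form w v *\<^sub>C u - J1_form w u *\<^sub>C v"
      have w: "J1_form w z = 0" if "z \<in> K \<union> N" for z
        using lr(3) that by (auto simp: w_def J1_orth_def)
      have w': "J1_form w' z = 0" if "z \<in> K \<union> N" for z
        using that by (simp add: w'_def J1_form_linear w)
      have "J1_form w' u = 0" "J1_form w' v = 0"
        by (simp_all add: w'_def J1_form_linear uu uv vu vv)
      then have "w' \<in> J1_orth K' \<inter> J1_orth N'"
        using w' by (auto simp: J1_orth_def K'_def N'_def J1_form_linear)
      moreover have "y - (l + J1_form w v *\<^sub>C u) - (r + J1_form w u *\<^sub>C v) = w'"
        by (simp add: w'_def w_def algebra_simps)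
      moreover have "l + J1_form w v *\<^sub>C u \<in> K'" "r + J1_form w u *\<^sub>C v \<in> N'"
        using lr(1,2) unfolding K'_def N'_def by blast+
      ultimately show ?thesis
        by (metis (no_types))
    qed
    have "\<exists>m\<in>M. f' - m \<in> N'" if "f' \<in> insert f F" for f'
    proof (cases "f' = f")
      case True
      \<comment> \<open>From f = k + n + x and x = v + (a/2) u, the terms \<open>k\<close> and (a/2)
        u go to \<open>M\<close>, and \<open>n\<close> and \<open>v\<close> to
        \<open>N'\<close>.\<close>
      have "k + (a / 2) *\<^sub>C u \<in> M"
        using kn(1) K(2) u(1) by (auto intro!: complex_vector.subspace_add complex_vector.subspace_scale M)
      moreover have "f - (k + (a / 2) *\<^sub>C u) = n + 1 *\<^sub>C v"
        by (simp add: v_def x_def scaleC_one algebra_simps)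
      ultimately show ?thesis
        using kn(2) True unfolding N'_def by blast
    next
      case False
      then show ?thesis
        using F that \<open>N \<subseteq> N'\<close> by blast
    qed
    show ?thesis
      unfolding J1_neutral_def
      by (intro exI[of _ K'] exI[of _ N'] conjI ballI) fact+
  qed
qed

text \<open>Taking a finite generating set of \<open>L\<close> as the prescribed set gives L = M +
  N. A vector of M \<inter> N is orthogonal to \<open>K\<close> since \<open>M\<close> is neutral,
  to \<open>N\<close> since \<open>N\<close> is neutral, and to every remainder, hence to all of
  \<open>L\<close>; nondegeneracy makes it zero.\<close>

lemma J1_neutral_complement_exists:
  fixes L M :: "('h::complex_inner \<times> 'h) set"
  assumes L: "csubspace L" "finite_dimensional L" and M: "csubspace M"
    and nondeg: "L \<inter> J1_orth L = {0}" and lag: "M = L \<inter> J1_orth M"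
  obtains N where "J1_neutral N" "direct_sum_of L M N"
proof -
  obtain F where F: "finite F" "L = cspan F"
    using L(2) unfolding finite_dimensional_def by blast
  then have "F \<subseteq> L"
    using complex_vector.span_superset by blast
  then obtain K N where K: "csubspace K" "K \<subseteq> M" and N: "J1_neutral N" "N \<subseteq> L"
    and dec: "\<forall>y\<in>L. \<exists>k\<in>K. \<exists>n\<in>N. y - k - n \<in> J1_orth K \<inter> J1_orth N"
    and FMN: "\<forall>f\<in>F. \<exists>m\<in>M. f - m \<in> N"
    using hyperbolic_extension[OF L(1) M nondeg lag F(1)] by blast
  have Ns: "csubspace N"
    using N(1) by (simp add: J1_neutral_def)
  have MsubL: "M \<subseteq> L"
    using lag by blast
  have "x = 0" if x: "x \<in> M" "x \<in> N" for x
  proof -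
    have "J1_form x y = 0" if "y \<in> L" for y
    proof -
      obtain l r where lr: "l \<in> K" "r \<in> N" "y - l - r \<in> J1_orth K \<inter> J1_orth N"
        using bspec[OF dec \<open>y \<in> L\<close>] by blast
      have "x \<in> J1_orth M"
        using x(1) lag by blast
      then have "J1_form x l = 0"
        using lr(1) K(2) by (auto simp: J1_orth_def)
      moreover have "J1_form x r = 0"
        using J1_neutral_orth[OF N(1)] x(2) lr(2) by blast
      moreover have "J1_form x (y - l - r) = 0"
        using lr(3) x(2) J1_form_zero_commute[of x] by (auto simp: J1_orth_def)
      ultimately show ?thesis
        by (simp add: J1_form_linear)
    qed
    then have "x \<in> L \<inter> J1_orth L"
      using x MsubL by (auto simp: J1_orth_def)
    then show ?thesis
      using nondeg by blast
  qed
  then have "M \<inter> N = {0}"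
    using complex_vector.subspace_0[OF M] complex_vector.subspace_0[OF Ns] by blast
  moreover have "L = {m + n | m n. m \<in> M \<and> n \<in> N}"
  proof
    have "F \<subseteq> {m + n | m n. m \<in> M \<and> n \<in> N}"
    proof
      fix f assume "f \<in> F"
      then obtain m where "m \<in> M" "f - m \<in> N"
        using FMN by blast
      then show "f \<in> {m + n | m n. m \<in> M \<and> n \<in> N}"
        by (intro CollectI exI[of _ m] exI[of _ "f - m"]) simp
    qed
    then show "L \<subseteq> {m + n | m n. m \<in> M \<and> n \<in> N}"
      unfolding F(2) by (rule complex_vector.span_minimal[OF _ complex_vector.subspace_sums[OF M Ns]])
    show "{m + n | m n. m \<in> M \<and> n \<in> N} \<subseteq> L"
      using MsubL N(2) complex_vector.subspace_add[OF L(1)] by blast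
  qed
  ultimately show ?thesis
    using that[OF N(1)] M Ns unfolding direct_sum_of_def by blast
qed

section \<open>Root subspaces\<close>

definition root_chain :: "'a::complex_inner lin_op \<Rightarrow> complex \<Rightarrow> nat \<Rightarrow> 'a set"
  where "root_chain T \<mu> m = ker_op (power_op (shift_op T \<mu>) m)"

lemma root_subspace_eq: "root_subspace T \<mu> = (\<Union>m. root_chain T \<mu> m)"
  by (simp add: root_subspace_def root_chain_def)

lemma root_chain_0: "root_chain T \<mu> 0 = {0}"
  by (auto simp: root_chain_def ker_op_def)

text \<open>Because \<open>power_op\<close> composes on the inside, all domain conditions of the
  iterated operator reduce to this one-step recursion, which is the shape required by
  \<open>primary_decomposition\<close>.\<close>

lemma root_chain_Suc:
  "x \<in> root_chain T \<mu> (Suc m) \<longleftrightarrow> x \<in> dom_op T \<and> app T x - \<mu> *\<^sub>C x \<in> root_chain T \<mu> m"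
  by (auto simp: root_chain_def ker_op_def comp_op_def shift_op_def)

context
  fixes T :: "'a::complex_inner lin_op"
  assumes T: "linear_op T"
begin

lemma dom_op_csubspace: "csubspace (dom_op T)"
  using T by (simp add: linear_op_def)

lemma app_add: "x \<in> dom_op T \<Longrightarrow> y \<in> dom_op T \<Longrightarrow> app T (x + y) = app T x + app T y"
  using T by (simp add: linear_op_def)

lemma app_scaleC: "x \<in> dom_op T \<Longrightarrow> app T (c *\<^sub>C x) = c *\<^sub>C app T x"
  using T by (simp add: linear_op_def)

lemma app_0: "app T 0 = 0"
  using app_scaleC[of 0 0] complex_vector.subspace_0[OF dom_op_csubspace] by simp

lemma csubspace_root_chain: "csubspace (root_chain T \<mu> m)"
proof (induction m)
  case 0
  show ?case by (simp add: root_chain_0 complex_vector.subspace_def)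
next
  case (Suc m)
  show ?case
  proof (rule complex_vector.subspaceI)
    show "0 \<in> root_chain T \<mu> (Suc m)"
      using complex_vector.subspace_0[OF Suc] complex_vector.subspace_0[OF dom_op_csubspace]
      by (simp add: root_chain_Suc app_0)
  next
    fix x y assume xy: "x \<in> root_chain T \<mu> (Suc m)" "y \<in> root_chain T \<mu> (Suc m)"
    then have "app T (x + y) - \<mu> *\<^sub>C (x + y) = (app T x - \<mu> *\<^sub>C x) + (app T y - \<mu> *\<^sub>C y)"
      by (simp add: root_chain_Suc app_add scaleC_add_right)
    then show "x + y \<in> root_chain T \<mu> (Suc m)"
      using xy complex_vector.subspace_add[OF Suc] complex_vector.subspace_add[OF dom_op_csubspace]
      unfolding root_chain_Suc by auto
  next
    fix c x assume x: "x \<in> root_chain T \<mu> (Suc m)"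
    then have "app T (c *\<^sub>C x) - \<mu> *\<^sub>C c *\<^sub>C x = c *\<^sub>C (app T x - \<mu> *\<^sub>C x)"
      by (simp add: root_chain_Suc app_scaleC complex_vector.scale_right_diff_distrib
          scaleC_scaleC mult.commute)
    then show "c *\<^sub>C x \<in> root_chain T \<mu> (Suc m)"
      using x complex_vector.subspace_scale[OF Suc] complex_vector.subspace_scale[OF dom_op_csubspace]
      unfolding root_chain_Suc by auto
  qed
qed

lemma root_chain_mono: "root_chain T \<mu> m \<subseteq> root_chain T \<mu> (Suc m)"
proof (induction m)
  case 0
  show ?case
    using complex_vector.subspace_0[OF csubspace_root_chain] by (simp add: root_chain_0)
qed (auto simp: root_chain_Suc)

lemma csubspace_root_subspace: "csubspace (root_subspace T \<mu>)"
  unfolding root_subspace_eq by (rule csubspace_incseq_Union) (rule csubspace_root_chain root_chain_mono)+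

lemma root_subspace_dom: "root_subspace T \<mu> \<subseteq> dom_op T"
  using root_chain_mono unfolding root_subspace_eq by (blast dest: root_chain_Suc[THEN iffD1])

lemma app_root_subspace:
  assumes "x \<in> root_subspace T \<mu>"
  shows "app T x \<in> root_subspace T \<mu>"
proof -
  obtain m where "x \<in> root_chain T \<mu> (Suc m)"
    using assms root_chain_mono unfolding root_subspace_eq by blast
  then have "app T x - \<mu> *\<^sub>C x \<in> root_subspace T \<mu>"
    unfolding root_subspace_eq root_chain_Suc by blast
  then have "(app T x - \<mu> *\<^sub>C x) + \<mu> *\<^sub>C x \<in> root_subspace T \<mu>"
    using assms by (intro complex_vector.subspace_add complex_vector.subspace_scale csubspace_root_subspace)
  then show ?thesis by simp
qed

text \<open>The last nonzero iterate of \<open>x\<close> under T - \<mu> is an eigenvector and does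
  not leave \<open>W\<close>. The case \<open>W = UNIV\<close> relates root vectors to the point
  spectrum of \<open>T\<close>, the case \<open>W = V k\<close> to the spectrum of the
  restriction.\<close>

lemma eigenvector_in_root_subspace:
  assumes "x \<in> root_subspace T \<mu>" "x \<in> W" "x \<noteq> 0" "csubspace W" "invariant_op T W"
  obtains y where "y \<in> W" "y \<in> dom_op T" "y \<noteq> 0" "app T y = \<mu> *\<^sub>C y"
proof -
  obtain m where "x \<in> root_chain T \<mu> m"
    using assms(1) by (auto simp: root_subspace_eq)
  then have "\<exists>y\<in>W \<inter> dom_op T. y \<noteq> 0 \<and> app T y = \<mu> *\<^sub>C y"
    using assms(2,3)
  proof (induction m arbitrary: x)
    case 0
    then show ?case by (simp add: root_chain_0)
  next
    case (Suc m)
    let ?y = "app T x - \<mu> *\<^sub>C x"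
    have x: "x \<in> dom_op T" "?y \<in> root_chain T \<mu> m"
      using Suc.prems by (auto simp: root_chain_Suc)
    have "?y \<in> W"
      using x(1) Suc.prems(2) assms(4,5)
      by (auto simp: invariant_op_def intro!: complex_vector.subspace_diff complex_vector.subspace_scale)
    then show ?case
      using Suc x by (cases "?y = 0") auto
  qed
  then show ?thesis
    using that by blast
qed

lemma root_subspace_trivial:
  assumes "\<mu> \<notin> point_spectrum T"
  shows "root_subspace T \<mu> = {0}"
proof -
  have "x = 0" if "x \<in> root_subspace T \<mu>" for x
  proof (rule ccontr)
    assume "x \<noteq> 0"
    then obtain y where "y \<in> dom_op T" "y \<noteq> 0" "app T y = \<mu> *\<^sub>C y"
      using eigenvector_in_root_subspace[OF \<open>x \<in> root_subspace T \<mu>\<close>, of UNIV]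
      by (auto simp: invariant_op_def complex_vector.subspace_UNIV)
    then show False
      using assms unfolding point_spectrum_def by blast
  qed
  then show ?thesis
    using complex_vector.subspace_0[OF csubspace_root_subspace] by blast
qed

lemma root_subspace_nontrivial:
  assumes "\<mu> \<in> point_spectrum T"
  obtains x where "x \<in> root_subspace T \<mu>" "x \<noteq> 0"
proof -
  obtain x where x: "x \<in> dom_op T" "x \<noteq> 0" "app T x = \<mu> *\<^sub>C x"
    using assms by (auto simp: point_spectrum_def)
  then have "x \<in> root_chain T \<mu> (Suc 0)"
    by (simp add: root_chain_Suc root_chain_0)
  then show ?thesis
    using x(2) that by (auto simp: root_subspace_eq)
qed

lemma finite_dimensional_root_decomposition:
  assumes V: "finite_dimensional V" and W: "csubspace W" "W \<subseteq> V" "W \<subseteq> dom_op T" "invariant_op T W"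
  shows "W \<subseteq> cspan (\<Union>\<mu>. W \<inter> root_subspace T \<mu>)"
proof
  fix x assume "x \<in> W"
  have inv: "\<And>x. x \<in> W \<Longrightarrow> app T x \<in> W"
    using W(3,4) by (auto simp: invariant_op_def)
  obtain p where p: "p \<noteq> 0" "poly_map (app T) p x = 0"
    using annihilating_poly_exists[where f = "app T", OF V W(2) inv \<open>x \<in> W\<close>] by blast
  show "x \<in> cspan (\<Union>\<mu>. W \<inter> root_subspace T \<mu>)"
    unfolding root_subspace_eq
  proof (rule primary_decomposition[where f = "app T" and p = p])
    show "x \<in> root_chain T \<mu> (Suc m) \<longleftrightarrow> app T x - \<mu> *\<^sub>C x \<in> root_chain T \<mu> m" if "x \<in> W" for x \<mu> m
      using that W(3) by (auto simp: root_chain_Suc)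
    show "root_chain T \<mu> m \<subseteq> root_chain T \<mu> (Suc m)" for \<mu> m
      by (rule root_chain_mono)
  qed (use W inv p \<open>x \<in> W\<close> in \<open>auto intro: app_add app_scaleC csubspace_root_chain
      simp: root_chain_0 subset_iff\<close>)
qed

end

text \<open>Induction on the sum of the two exponents: replacing \<open>x\<close> by (T - \<mu>) x
  or \<open>y\<close> by (T - \<nu>) y lowers it, and skew-symmetry cancels the terms with
  \<open>T\<close>, leaving (\<mu> + cnj \<nu>) \<langle>x|y\<rangle> = 0. The conjugate stems from
  the second argument of the form.\<close>

lemma J1_orth_root_subspaces:
  assumes T: "hamiltonian T" and "\<mu> + cnj \<nu> \<noteq> 0"
    and "x \<in> root_subspace T \<mu>" "y \<in> root_subspace T \<nu>"
  shows "J1_form x y = 0"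
proof -
  have "J1_form x y = 0" if "x \<in> root_chain T \<mu> m" "y \<in> root_chain T \<nu> n" for m n
    using that
  proof (induction "m + n" arbitrary: m n x y rule: less_induct)
    case less
    show ?case
    proof (cases "m = 0 \<or> n = 0")
      case True
      then show ?thesis
        using less.prems by (auto simp: root_chain_0)
    next
      case False
      then obtain m' n' where mn: "m = Suc m'" "n = Suc n'"
        by (metis not0_implies_Suc)
      have "J1_form (app T x - \<mu> *\<^sub>C x) y = 0" "J1_form x (app T y - \<nu> *\<^sub>C y) = 0"
        using less.hyps[of m' n] less.hyps[of m n'] less.prems by (auto simp: mn root_chain_Suc)
      then have "(\<mu> + cnj \<nu>) * J1_form x y = J1_form (app T x) y + J1_form x (app T y)"
        by (simp add: J1_form_linear distrib_right)
      also have "\<dots> = 0"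
        using hamiltonian_skew_symmetric[OF T] less.prems by (simp add: mn root_chain_Suc)
      finally have "(\<mu> + cnj \<nu>) * J1_form x y = 0" .
      then show ?thesis
        using assms(2) by simp
    qed
  qed
  then show ?thesis
    using assms(3,4) by (auto simp: root_subspace_eq)
qed


section \<open>Projections of a Riesz basis of subspaces\<close>

text \<open>Gram-Schmidt along the generators: the residual \<open>b - q\<close> of the new
  generator is orthogonal to the old span, and \<open>c\<close> removes the component of
  \<open>x - p\<close> along it.\<close>

lemma cspan_finite_projection_exists:
  fixes x :: "'a::complex_inner"
  assumes "finite F"
  shows "\<exists>p\<in>cspan F. \<forall>y\<in>cspan F. cinner (x - p) y = 0"
  using assms
proof (induction F arbitrary: x)
  case empty
  show ?case by auto
next
  case (insert b F)
  obtain p where p: "p \<in> cspan F" "\<forall>y\<in>cspan F. cinner (x - p) y = 0"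
    using insert.IH by blast
  obtain q where q: "q \<in> cspan F" "\<forall>y\<in>cspan F. cinner (b - q) y = 0"
    using insert.IH by blast
  have sub: "cspan F \<subseteq> cspan (insert b F)"
    by (rule complex_vector.span_mono) blast
  show ?case
  proof (cases "b = q")
    case True
    then show ?thesis
      using p q(1) complex_vector.span_redundant by metis
  next
    case False
    define u where "u = b - q"
    define c where "c = cinner (x - p) u / cinner u u"
    have "cinner u u \<noteq> 0"
      using False by (simp add: u_def cinner_eq_zero_iff)
    then have u: "cinner (x - (p + c *\<^sub>C u)) u = 0"
      by (simp add: c_def cinner_diff_left cinner_add_left cinner_scaleC_left)
    have "p + c *\<^sub>C u \<in> cspan (insert b F)"
      unfolding u_def using sub p(1) q(1) complex_vector.span_base[of b "insert b F"]
      by (intro complex_vector.span_add complex_vector.span_scale complex_vector.span_diff) auto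
    moreover have "cinner (x - (p + c *\<^sub>C u)) y = 0" if "y \<in> cspan (insert b F)" for y
    proof -
      obtain k where k: "y - k *\<^sub>C b \<in> cspan F"
        using complex_vector.span_breakdown[OF insertI1 \<open>y \<in> cspan (insert b F)\<close>] complex_vector.span_mono[of "insert b F - {b}" F]
        by blast
      \<comment> \<open>Replacing \<open>b\<close> by u + q and absorbing the multiple of
        \<open>q\<close> into the old span writes \<open>y\<close> as a multiple of \<open>u\<close>
        plus a vector of \<open>cspan F\<close>.\<close>
      define z where "z = (y - k *\<^sub>C b) + k *\<^sub>C q"
      have z: "z \<in> cspan F"
        unfolding z_def by (intro complex_vector.span_add complex_vector.span_scale k q(1))
      have "y = k *\<^sub>C u + z"
        by (simp add: u_def z_def complex_vector.scale_right_diff_distrib)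
      moreover have "cinner (x - (p + c *\<^sub>C u)) z = 0"
        using p(2) q(2) z by (simp add: cinner_diff_left cinner_add_left cinner_scaleC_left u_def)
      ultimately show ?thesis
        using u by (simp add: cinner_add_right cinner_scaleC_right)
    qed
    ultimately show ?thesis by blast
  qed
qed

lemma norm_le_of_orthogonal:
  assumes "cinner (x - p) p = 0"
  shows "norm p \<le> norm x" "norm (x - p) \<le> norm x"
proof -
  have "inner (x - p) p = 0"
    using assms by (simp add: inner_eq_Re_cinner)
  then have "(norm x)\<^sup>2 = (norm (x - p))\<^sup>2 + (norm p)\<^sup>2"
    using norm_add_Pythagorean[of "x - p" p] by (simp add: orthogonal_def)
  then have "(norm p)\<^sup>2 \<le> (norm x)\<^sup>2" "(norm (x - p))\<^sup>2 \<le> (norm x)\<^sup>2"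
    by simp_all
  then show "norm p \<le> norm x" "norm (x - p) \<le> norm x"
    by (simp_all add: power2_le_iff_abs_le)
qed

text \<open>The expansion property in terms of coordinate projections, without reference to an
  isomorphism or to orthogonality, so that the same interface serves the orthogonal family and its
  preimage.\<close>

locale riesz_projections =
  fixes V :: "nat \<Rightarrow> 'a::complex_inner set" and P :: "nat \<Rightarrow> 'a \<Rightarrow> 'a"
  assumes P_bounded_linear: "bounded_linear (P k)"
    and P_scaleC: "P k (c *\<^sub>C x) = c *\<^sub>C P k x"
    and P_in: "P k x \<in> V k"
    and P_same: "x \<in> V k \<Longrightarrow> P k x = x"
    and P_other: "j \<noteq> k \<Longrightarrow> x \<in> V j \<Longrightarrow> P k x = 0"
    and P_sums: "(\<lambda>k. P k x) sums x"

text \<open>The partial sums \<open>S n\<close> are orthogonal projections, so x - S n x is bounded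
  in norm by \<open>x\<close> uniformly in \<open>n\<close>. On the dense span they eventually act
  as the identity, and the uniform bound carries convergence to every \<open>x\<close>.\<close>

lemma orthogonal_expansion:
  fixes E :: "nat \<Rightarrow> 'a::complex_inner set"
  assumes sub: "\<And>k. csubspace (E k)" and proj: "\<And>k x. \<exists>p\<in>E k. \<forall>y\<in>E k. cinner (x - p) y = 0"
    and orth: "\<And>j k x y. j \<noteq> k \<Longrightarrow> x \<in> E j \<Longrightarrow> y \<in> E k \<Longrightarrow> cinner x y = 0"
    and dense: "closure (cspan (\<Union>k. E k)) = UNIV"
  obtains Q where "riesz_projections E Q"
proof -
  define Q where "Q k x = (SOME p. p \<in> E k \<and> (\<forall>y\<in>E k. cinner (x - p) y = 0))" for k x
  have Q: "Q k x \<in> E k" "y \<in> E k \<Longrightarrow> cinner (x - Q k x) y = 0" for k x y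
    using someI_ex[OF proj[of k x, unfolded Bex_def]] unfolding Q_def by blast+
  \<comment> \<open>Uniqueness of the orthogonal projection: linearity of the chosen
    \<open>Q k\<close> and its values on every \<open>E j\<close> are read off from it.\<close>
  have eqI: "Q k x = p" if p: "p \<in> E k" "\<And>y. y \<in> E k \<Longrightarrow> cinner (x - p) y = 0" for k x p
  proof -
    have d: "p - Q k x \<in> E k"
      using complex_vector.subspace_diff[OF sub p(1) Q(1)] .
    have "cinner (p - Q k x) (p - Q k x) = cinner ((x - Q k x) - (x - p)) (p - Q k x)"
      by simp
    also have "\<dots> = 0"
      unfolding cinner_diff_left[of "x - Q k x" "x - p"] using p(2)[OF d] Q(2)[OF d] by simp
    finally show ?thesis
      by (simp add: cinner_eq_zero_iff)
  qed
  have Q_add: "Q k (x + y) = Q k x + Q k y" for k x y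
  proof (rule eqI)
    fix z assume "z \<in> E k"
    then have "cinner ((x - Q k x) + (y - Q k y)) z = 0"
      by (simp only: cinner_add_left Q(2) add_0)
    then show "cinner (x + y - (Q k x + Q k y)) z = 0"
      by (simp add: algebra_simps)
  qed (intro complex_vector.subspace_add sub Q)
  have Q_scale: "Q k (c *\<^sub>C x) = c *\<^sub>C Q k x" for k c x
  proof (rule eqI)
    fix z assume "z \<in> E k"
    then have "cinner (c *\<^sub>C (x - Q k x)) z = 0"
      by (simp only: cinner_scaleC_left Q(2) mult_zero_right)
    then show "cinner (c *\<^sub>C x - c *\<^sub>C Q k x) z = 0"
      by (simp add: complex_vector.scale_right_diff_distrib)
  qed (intro complex_vector.subspace_scale sub Q)
  have Q_norm: "norm (Q k x) \<le> norm x" for k x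
    by (rule norm_le_of_orthogonal(1)[OF Q(2)[OF Q(1)]])
  have bl: "bounded_linear (Q k)" for k
    by (rule bounded_linear_intro[where K = 1])
      (simp_all add: Q_add Q_scale scaleR_scaleC Q_norm)
  have Q_same: "Q k x = x" if "x \<in> E k" for k x
    by (rule eqI) (use that in simp_all)
  have Q_other: "Q k x = 0" if "j \<noteq> k" "x \<in> E j" for j k x
    by (rule eqI) (use that orth complex_vector.subspace_0[OF sub] in auto)
  define S where "S n x = (\<Sum>k<n. Q k x)" for n x
  have S_add: "S n (x + y) = S n x + S n y" and S_scale: "S n (c *\<^sub>C x) = c *\<^sub>C S n x" for n x y c
    by (simp_all add: S_def Q_add Q_scale sum.distrib complex_vector.scale_sum_right)
  have sum_right: "cinner z (\<Sum>k\<in>A. h k) = (\<Sum>k\<in>A. cinner z (h k))"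
    and sum_left: "cinner (\<Sum>k\<in>A. h k) z = (\<Sum>k\<in>A. cinner (h k) z)" for z h and A :: "nat set"
    by (induction A rule: infinite_finite_induct) (simp_all add: cinner_add_right cinner_add_left)
  have S_norm: "norm (x - S n x) \<le> norm x" for n x
  proof -
    have "cinner (x - S n x) (Q j x) = 0" if "j < n" for j
    proof -
      have "cinner (S n x) (Q j x) = (\<Sum>k<n. if k = j then cinner (Q j x) (Q j x) else 0)"
        unfolding S_def sum_left by (intro sum.cong) (auto intro: orth[OF _ Q(1) Q(1)])
      also have "\<dots> = cinner (Q j x) (Q j x)"
        using that by simp
      finally show ?thesis
        using Q(2)[OF Q(1), of x j x] by (simp add: cinner_diff_left)
    qed
    then have "cinner (x - S n x) (S n x) = 0"
      unfolding S_def[of n x] sum_right by (simp add: S_def)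
    then show ?thesis
      by (rule norm_le_of_orthogonal(2))
  qed
  have S_span: "\<forall>\<^sub>F n in sequentially. S n u = u" if "u \<in> cspan (\<Union>k. E k)" for u
    using that
  proof (induction rule: complex_vector.span_induct_alt)
    case base
    show ?case
      using S_scale[of _ 0 0] by simp
  next
    case (step c x y)
    then obtain j where j: "x \<in> E j" by blast
    have "S n x = x" if "n \<ge> Suc j" for n
    proof -
      have "S n x = (\<Sum>k<n. if k = j then x else 0)"
        unfolding S_def using j Q_same Q_other[OF _ j] by (intro sum.cong) auto
      then show ?thesis
        using that by simp
    qed
    then have "\<forall>\<^sub>F n in sequentially. S n x = x"
      unfolding eventually_sequentially by blast
    with step.IH show ?case
      by eventually_elim (simp add: S_add S_scale)
  qed
  have "(\<lambda>n. S n x) \<longlonglongrightarrow> x" for x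
  proof (rule tendstoI)
    fix e :: real assume "e > 0"
    then obtain u where u: "u \<in> cspan (\<Union>k. E k)" "dist u x < e"
      using dense closure_approachable by blast
    have "dist (S n x) x \<le> norm (x - u)" if "S n u = u" for n
    proof -
      have "S n x = S n (x - u) + u"
        using S_add[of n "x - u" u] that by simp
      then have "x - S n x = (x - u) - S n (x - u)"
        by (simp add: algebra_simps)
      then show ?thesis
        using S_norm[of "x - u" n] by (metis dist_commute dist_norm)
    qed
    then show "\<forall>\<^sub>F n in sequentially. dist (S n x) x < e"
      using S_span[OF u(1)] u(2)
      by (auto elim!: eventually_mono intro: le_less_trans simp: dist_norm norm_minus_commute)
  qed
  then have "(\<lambda>k. Q k x) sums x" for x
    by (simp add: sums_def S_def)
  then show ?thesis
    by (intro that[of Q] riesz_projections.intro bl Q_scale Q(1) Q_same Q_other)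
qed

text \<open>The orthogonal projections onto the images under \<Phi>, which exist because these are
  finite-dimensional, are conjugated by \<Phi>; boundedness of the inverse of \<Phi> transports the
  convergent expansions.\<close>

lemma riesz_projections_exist:
  fixes V :: "nat \<Rightarrow> 'a::complex_inner set"
  assumes "riesz_basis_of_subspaces V" "\<And>k. finite_dimensional (V k)"
  obtains P where "riesz_projections V P"
proof -
  obtain \<Phi> where \<Phi>: "hilbert_isomorphism \<Phi>"
    and orth: "\<And>j k x y. j \<noteq> k \<Longrightarrow> x \<in> \<Phi> ` V j \<Longrightarrow> y \<in> \<Phi> ` V k \<Longrightarrow> cinner x y = 0"
    and dense: "closure (subspace_sum (\<lambda>k. \<Phi> ` V k)) = UNIV"
    using assms(1) unfolding riesz_basis_of_subspaces_def by metis
  have bij: "bij \<Phi>" and bl: "bounded_linear \<Phi>" "bounded_linear (inv \<Phi>)"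
    and "Vector_Spaces.linear scaleC scaleC \<Phi>"
    using \<Phi> by (auto simp: hilbert_isomorphism_def)
  then interpret \<Phi>: Vector_Spaces.linear scaleC scaleC \<Phi>
    by blast
  have scale_inv: "inv \<Phi> (c *\<^sub>C x) = c *\<^sub>C inv \<Phi> x" for c x
    using bij \<Phi>.scale[of c "inv \<Phi> x"] by (metis bij_inv_eq_iff)
  have image: "\<exists>F. finite F \<and> \<Phi> ` V k = cspan F" for k
  proof -
    obtain F where "finite F" "V k = cspan F"
      using assms(2) unfolding finite_dimensional_def by blast
    then show ?thesis
      using \<Phi>.span_image[of F] by (intro exI[of _ "\<Phi> ` F"]) (simp add: cspan_def)
  qed
  have sub: "csubspace (\<Phi> ` V k)" for k
    using image[of k] complex_vector.subspace_span by auto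
  have proj: "\<exists>p\<in>\<Phi> ` V k. \<forall>y\<in>\<Phi> ` V k. cinner (x - p) y = 0" for k x
    using image[of k] cspan_finite_projection_exists by metis
  obtain Q where "riesz_projections (\<lambda>k. \<Phi> ` V k) Q"
    using orthogonal_expansion[where E = "\<lambda>k. \<Phi> ` V k",
        OF sub proj _ dense[unfolded subspace_sum_def]] orth by blast
  then interpret Q: riesz_projections "\<lambda>k. \<Phi> ` V k" Q .
  have inv\<Phi>: "inv \<Phi> (\<Phi> x) = x" for x
    using bij by (simp add: bij_is_inj)
  have "riesz_projections V (\<lambda>k x. inv \<Phi> (Q k (\<Phi> x)))"
  proof (rule riesz_projections.intro)
    show "bounded_linear (\<lambda>x. inv \<Phi> (Q k (\<Phi> x)))" for k
      by (intro bounded_linear_compose[OF bl(2)] bounded_linear_compose[OF Q.P_bounded_linear] bl(1))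
    show "inv \<Phi> (Q k (\<Phi> (c *\<^sub>C x))) = c *\<^sub>C inv \<Phi> (Q k (\<Phi> x))" for k c x
      by (simp add: \<Phi>.scale Q.P_scaleC scale_inv)
    show "inv \<Phi> (Q k (\<Phi> x)) \<in> V k" for k x
      using Q.P_in[of k "\<Phi> x"] inv\<Phi> by auto
    show "inv \<Phi> (Q k (\<Phi> x)) = x" if "x \<in> V k" for k x
      using that by (simp add: Q.P_same inv\<Phi>)
    show "inv \<Phi> (Q k (\<Phi> x)) = 0" if "j \<noteq> k" "x \<in> V j" for j k x
      using Q.P_other[OF that(1) imageI[OF that(2)]]
      by (simp add: linear_0 bounded_linear.linear bl(2))
    show "(\<lambda>k. inv \<Phi> (Q k (\<Phi> x))) sums x" for x
      using bounded_linear.sums[OF bl(2) Q.P_sums[of "\<Phi> x"]] by (simp add: inv\<Phi>)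
  qed
  then show ?thesis
    using that by blast
qed


section \<open>The root subspaces of a Hamiltonian with a finitely spectral Riesz basis\<close>

locale spectral_hamiltonian = riesz_projections V P
  for V :: "nat \<Rightarrow> ('h::chilbert_space \<times> 'h) set" and P +
  fixes T :: "('h \<times> 'h) lin_op"
  assumes hamiltonian: "hamiltonian T" and closed_op: "closed_op T"
    and basis: "finitely_spectral T V"
begin

lemma T_linear: "linear_op T"
  by (rule hamiltonian_linear_op[OF hamiltonian])

lemma V_csubspace: "csubspace (V k)" and V_closed: "closed (V k)"
  using basis by (simp_all add: finitely_spectral_def riesz_basis_of_subspaces_def)

lemma V_finite_dimensional: "finite_dimensional (V k)"
  and V_dom: "V k \<subseteq> dom_op T" and V_invariant: "invariant_op T (V k)"
  and V_spectra: "j \<noteq> k \<Longrightarrow> spectrum_on (V j) (restrict_op T (V j)) \<inter>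
      spectrum_on (V k) (restrict_op T (V k)) = {}"
  and V_core: "core_op T (subspace_sum V)"
  using basis by (simp_all add: finitely_spectral_def)

lemma app_V: "x \<in> V k \<Longrightarrow> app T x \<in> V k"
  using V_dom V_invariant unfolding invariant_op_def by blast

lemma P_add: "P k (x + y) = P k x + P k y"
  by (rule linear_add[OF bounded_linear.linear[OF P_bounded_linear]])

lemma P_diff: "P k (x - y) = P k x - P k y"
  by (rule linear_diff[OF bounded_linear.linear[OF P_bounded_linear]])

lemma P_zero: "P k 0 = 0"
  by (rule linear_0[OF bounded_linear.linear[OF P_bounded_linear]])

text \<open>Partial sums of the expansion stay in \<open>U\<close> and converge to \<open>x\<close>;
  questions about infinite expansions thereby reduce to single components.\<close>

lemma in_closed_csubspace_of_P:
  assumes "csubspace U" "closed U" "\<And>k. P k x \<in> U"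
  shows "x \<in> U"
proof (rule closed_sequentially[OF assms(2)])
  show "(\<lambda>n. \<Sum>k<n. P k x) \<longlonglongrightarrow> x"
    using P_sums[of x] by (simp add: sums_def)
qed (intro complex_vector.subspace_sum[OF assms(1)] assms(3))

text \<open>On a vector of \<open>V j\<close> both sides equal its image under \<open>T\<close> if j
  = k and vanish otherwise, as \<open>V j\<close> is invariant. The induction carries membership in
  the domain along, since \<open>app T\<close> is known to be additive only there.\<close>

lemma P_app_subspace_sum:
  assumes "x \<in> subspace_sum V"
  shows "app T (P k x) = P k (app T x)"
proof -
  have "x \<in> dom_op T \<and> app T (P k x) = P k (app T x)"
    using assms unfolding subspace_sum_def
  proof (induction rule: complex_vector.span_induct_alt)
    case base
    show ?case
      by (simp add: P_zero app_0[OF T_linear] complex_vector.subspace_0[OF dom_op_csubspace[OF T_linear]])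
  next
    case (step c x y)
    then obtain j where j: "x \<in> V j" by blast
    have x: "x \<in> dom_op T" and P_dom: "P k z \<in> dom_op T" for z
      using j V_dom P_in by blast+
    have cx: "c *\<^sub>C x \<in> dom_op T" "c *\<^sub>C P k x \<in> dom_op T"
      by (intro complex_vector.subspace_scale dom_op_csubspace T_linear x P_dom)+
    have "app T (P k x) = P k (app T x)"
      using j app_V[OF j] app_0[OF T_linear]
      by (cases "j = k") (auto simp: P_same P_other[OF _ j] P_other[OF _ app_V[OF j]])
    then show ?case
      using step.IH x cx P_dom complex_vector.subspace_add[OF dom_op_csubspace[OF T_linear]]
      by (simp add: P_add P_scaleC app_add[OF T_linear] app_scaleC[OF T_linear])
  qed
  then show ?thesis ..
qed

text \<open>The core property carries the commutation over to the whole domain, because \<open>T\<close> is closed.\<close>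

lemma P_app:
  assumes "x \<in> dom_op T"
  shows "app T (P k x) = P k (app T x)"
proof -
  obtain u where u: "\<And>n. u n \<in> subspace_sum V" "u \<longlonglongrightarrow> x" "(\<lambda>n. app T (u n)) \<longlonglongrightarrow> app T x"
    using V_core assms unfolding core_op_def by metis
  let ?G = "(\<lambda>x. (x, app T x)) ` dom_op T"
  have "(\<lambda>n. (P k (u n), app T (P k (u n)))) \<longlonglongrightarrow> (P k x, P k (app T x))"
    unfolding P_app_subspace_sum[OF u(1)]
    by (intro tendsto_Pair bounded_linear.tendsto[OF P_bounded_linear] u)
  moreover have "(P k (u n), app T (P k (u n))) \<in> ?G" for n
    using P_in V_dom by blast
  ultimately have "(P k x, P k (app T x)) \<in> ?G"
    using closed_op unfolding closed_op_def by (metis (no_types, lifting) closed_sequentially)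
  then show ?thesis
    by auto
qed

lemma P_root_subspace:
  assumes "x \<in> root_subspace T \<mu>"
  shows "P k x \<in> root_subspace T \<mu>"
proof -
  have "P k x \<in> root_chain T \<mu> m" if "x \<in> root_chain T \<mu> m" for m
    using that
  proof (induction m arbitrary: x)
    case 0
    then show ?case by (simp add: root_chain_0 P_zero)
  next
    case (Suc m)
    then have "P k (app T x - \<mu> *\<^sub>C x) \<in> root_chain T \<mu> m" "x \<in> dom_op T"
      by (auto simp: root_chain_Suc)
    then show ?case
      using subsetD[OF V_dom P_in[of k x]] by (simp add: root_chain_Suc P_diff P_scaleC P_app)
  qed
  then show ?thesis
    using assms by (auto simp: root_subspace_eq)
qed

lemma root_vector_spectrum:
  assumes "x \<in> root_subspace T \<mu>" "x \<in> V k" "x \<noteq> 0"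
  shows "\<mu> \<in> spectrum_on (V k) (restrict_op T (V k))"
proof -
  obtain y where y: "y \<in> V k" "y \<in> dom_op T" "y \<noteq> 0" "app T y = \<mu> *\<^sub>C y"
    using eigenvector_in_root_subspace[OF T_linear assms V_csubspace V_invariant] by blast
  have "0 \<in> dom_op T \<inter> V k"
    using complex_vector.subspace_0[OF V_csubspace] V_dom by blast
  then have "\<not> inj_on (\<lambda>x. app T x - \<mu> *\<^sub>C x) (dom_op T \<inter> V k)"
    using y app_0[OF T_linear] unfolding inj_on_def by force
  then show ?thesis
    by (auto simp: spectrum_on_def resolvent_set_on_def bij_betw_def shift_op_def restrict_op_def)
qed

lemma root_subspace_index_unique:
  assumes "x \<in> root_subspace T \<mu>" "x \<in> V j" "x \<noteq> 0" "y \<in> root_subspace T \<mu>" "y \<in> V k" "y \<noteq> 0"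
  shows "j = k"
  using root_vector_spectrum[OF assms(1-3)] root_vector_spectrum[OF assms(4-6)] V_spectra by blast

lemma root_subspace_subset_V:
  obtains k where "root_subspace T \<mu> \<subseteq> V k"
proof (cases "\<exists>x\<in>root_subspace T \<mu>. \<exists>k. P k x \<noteq> 0")
  case True
  then obtain x k where x: "x \<in> root_subspace T \<mu>" "P k x \<noteq> 0"
    by blast
  have "y \<in> V k" if y: "y \<in> root_subspace T \<mu>" for y
  proof (rule in_closed_csubspace_of_P[OF V_csubspace V_closed])
    fix j
    show "P j y \<in> V k"
    proof (cases "P j y = 0")
      case False
      then have "j = k"
        using root_subspace_index_unique[OF P_root_subspace[OF y] P_in False P_root_subspace[OF x(1)] P_in x(2)]
        by blast
      then show ?thesis
        using P_in by blast
    qed (simp add: complex_vector.subspace_0[OF V_csubspace])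
  qed
  then show ?thesis
    using that by blast
next
  case False
  \<comment> \<open>All components of all root vectors vanish here, so the root subspace is {0} and
    any index serves.\<close>
  have "y = 0" if "y \<in> root_subspace T \<mu>" for y
  proof -
    have "(\<lambda>k. P k y) = (\<lambda>_. 0)"
      using False that by auto
    then show ?thesis
      using sums_unique2[OF P_sums[of y]] by (metis sums_zero)
  qed
  then show ?thesis
    using that complex_vector.subspace_0[OF V_csubspace] by blast
qed

text \<open>Besides \<open>V k\<close> itself, the subspace \<open>W\<close> will be the part of a
  given invariant \<open>U\<close> in \<open>V k\<close>.\<close>

lemma V_root_decomposition:
  assumes "csubspace W" "W \<subseteq> V k" "invariant_op T W"
  shows "W \<subseteq> cspan (\<Union>\<mu>. W \<inter> root_subspace T \<mu>)"
  using finite_dimensional_root_decomposition[OF T_linear V_finite_dimensional assms(1,2) _ assms(3)]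
    assms(2) V_dom by blast

lemma root_subspaces_dense: "closure (cspan (\<Union>\<mu>. root_subspace T \<mu>)) = UNIV"
proof -
  let ?U = "closure (cspan (\<Union>\<mu>. root_subspace T \<mu>))"
  have "x \<in> ?U" for x
  proof (rule in_closed_csubspace_of_P)
    show "csubspace ?U"
      by (intro csubspace_closure complex_vector.subspace_span)
    fix k
    have "P k x \<in> cspan (\<Union>\<mu>. V k \<inter> root_subspace T \<mu>)"
      using V_root_decomposition[OF V_csubspace order_refl V_invariant] P_in by blast
    also have "\<dots> \<subseteq> cspan (\<Union>\<mu>. root_subspace T \<mu>)"
      by (rule complex_vector.span_mono) blast
    finally show "P k x \<in> ?U"
      using closure_subset by blast
  qed simp
  then show ?thesis by blast
qed

text \<open>Such an \<open>x\<close> is orthogonal to every root subspace, and these span a dense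
  subspace. No eigenvalue is presupposed: if - cnj \<mu> is none, its root subspace is {0} and the
  conclusion applies to every root vector for \<mu>, whence the symmetry of the point
  spectrum.\<close>

lemma root_subspace_nondegenerate:
  assumes "x \<in> root_subspace T \<mu>" "x \<in> J1_orth (root_subspace T (- cnj \<mu>))"
  shows "x = 0"
proof -
  have "J1_form x y = 0" if y: "y \<in> root_subspace T \<nu>" for y \<nu>
  proof (cases "\<mu> + cnj \<nu> = 0")
    case True
    then have "\<nu> = - cnj \<mu>"
      by (metis add.inverse_unique complex_cnj_cnj complex_cnj_minus minus_unique)
    then show ?thesis
      using assms(2) y by (simp add: J1_orth_def)
  next
    case False
    then show ?thesis
      using J1_orth_root_subspaces[OF hamiltonian _ assms(1) y] by blast
  qed
  then have "x \<in> J1_orth (\<Union>\<mu>. root_subspace T \<mu>)"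
    unfolding J1_orth_def by blast
  then show ?thesis
    using J1_orth_dense[OF root_subspaces_dense] by simp
qed

lemma point_spectrum_symmetric:
  assumes "\<mu> \<in> point_spectrum T"
  shows "- cnj \<mu> \<in> point_spectrum T"
proof (rule ccontr)
  assume "- cnj \<mu> \<notin> point_spectrum T"
  then have "root_subspace T (- cnj \<mu>) = {0}"
    by (rule root_subspace_trivial[OF T_linear])
  moreover obtain x where "x \<in> root_subspace T \<mu>" "x \<noteq> 0"
    using root_subspace_nontrivial[OF T_linear assms] by blast
  ultimately show False
    using root_subspace_nondegenerate[of x \<mu>] by (simp add: J1_orth_def)
qed

text \<open>
  The form of \<open>x\<close> with a root vector for \<open>- cnj \<mu>\<close> only sees the component \<open>g \<mu>\<close> of \<open>x\<close>,
  as all other components belong to root subspaces orthogonal to that of \<open>- cnj \<mu>\<close>.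
\<close>

lemma J1_form_root_component:
  assumes A: "finite A" "\<And>\<nu>. \<nu> \<in> A \<Longrightarrow> g \<nu> \<in> V k \<inter> root_subspace T \<nu>"
    and Pk: "P k x = (\<Sum>\<nu>\<in>A. g \<nu>)" and \<mu>: "\<mu> \<in> A" "g \<mu> \<noteq> 0"
    and y: "y \<in> root_subspace T (- cnj \<mu>)"
  shows "J1_form (g \<mu>) y = J1_form x y"
proof -
  have other: "J1_form z y = 0" if "z \<in> root_subspace T \<nu>" "\<nu> \<noteq> \<mu>" for z \<nu>
    using J1_orth_root_subspaces[OF hamiltonian _ that(1) y] that(2) by simp
  have form_sum: "J1_form (\<Sum>i\<in>B. h i) y = (\<Sum>i\<in>B. J1_form (h i) y)" for h and B :: "'i set"
    by (induction B rule: infinite_finite_induct) (simp_all add: J1_form_linear)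
  \<comment> \<open>As \<open>g \<mu>\<close> is a nonzero root vector in \<open>V k\<close>, no
    other \<open>V j\<close> contains one for \<mu>; hence \<open>P j x\<close> is a sum of root
    vectors for other eigenvalues, all orthogonal to \<open>y\<close>.\<close>
  have Pj: "J1_form (P j x) y = 0" if "j \<noteq> k" for j
  proof -
    have "V j \<inter> root_subspace T \<mu> \<subseteq> {0}"
      using root_subspace_index_unique[of _ \<mu> j "g \<mu>" k] A(2)[OF \<mu>(1)] \<mu>(2) that by blast
    then have "V j \<inter> root_subspace T \<nu> \<subseteq> J1_orth {y}" for \<nu>
      using other by (cases "\<nu> = \<mu>") (fastforce simp: J1_orth_def)+
    then have "cspan (\<Union>\<nu>. V j \<inter> root_subspace T \<nu>) \<subseteq> J1_orth {y}"
      by (intro complex_vector.span_minimal csubspace_J1_orth) blast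
    then have "P j x \<in> J1_orth {y}"
      using V_root_decomposition[OF V_csubspace order_refl V_invariant] P_in by blast
    then show ?thesis
      by (simp add: J1_orth_def)
  qed
  have "x - P k x \<in> J1_orth {y}"
  proof (rule in_closed_csubspace_of_P[OF csubspace_J1_orth closed_J1_orth])
    fix j
    have "P j (x - P k x) = (if j = k then 0 else P j x)"
      using P_same[OF P_in] P_other[OF _ P_in] by (auto simp: P_diff)
    then show "P j (x - P k x) \<in> J1_orth {y}"
      using Pj by (simp add: J1_orth_def)
  qed
  then have "J1_form x y = J1_form (P k x) y"
    by (simp add: J1_orth_def J1_form_linear)
  also have "\<dots> = (\<Sum>\<nu>\<in>A. J1_form (g \<nu>) y)"
    by (simp only: Pk form_sum)
  also have "\<dots> = (\<Sum>\<nu>\<in>A. if \<nu> = \<mu> then J1_form (g \<mu>) y else 0)"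
    using A(2) by (intro sum.cong refl) (metis IntD2 other)
  also have "\<dots> = J1_form (g \<mu>) y"
    using A(1) \<mu>(1) by simp
  finally show ?thesis by simp
qed

section \<open>Sufficiency: the closed span is hypermaximal neutral, invariant and
  compatible\<close>

theorem hypermaximal_of_neutral_decompositions:
  assumes MN: "\<And>t. \<i> * complex_of_real t \<in> imag_point_spectrum T \<Longrightarrow>
      neutral_decomposition T (\<i> * complex_of_real t) (M t) (N t)"
    and \<sigma>: "sc_set T \<sigma>"
  defines "S \<equiv> (\<Union>\<mu>\<in>\<sigma>. root_subspace T \<mu>) \<union>
      (\<Union>t\<in>{t. \<i> * complex_of_real t \<in> imag_point_spectrum T}. M t)"
  shows "hypermaximal_J1_neutral (closure (cspan S))" "invariant_op T (closure (cspan S))"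
    "compatible_subspace V (closure (cspan S))"
proof -
  let ?U = "closure (cspan S)"
  let ?I = "{t. \<i> * complex_of_real t \<in> imag_point_spectrum T}"
  have U_sub: "csubspace ?U"
    by (intro csubspace_closure complex_vector.subspace_span)
  have SU: "S \<subseteq> ?U"
    using complex_vector.span_superset closure_subset by blast
  have M_root: "M t \<subseteq> root_subspace T (\<i> * complex_of_real t)" if "t \<in> ?I" for t
  proof -
    have "csubspace (N t)" "root_subspace T (\<i> * complex_of_real t) = {m + n | m n. m \<in> M t \<and> n \<in> N t}"
      using MN that by (auto simp: neutral_decomposition_def direct_sum_of_def)
    then show ?thesis
      using complex_vector.subspace_0[of "N t"] by (metis (mono_tags, lifting) CollectI add.right_neutral subsetI)
  qed
  have S_disj: "(\<exists>\<mu>\<in>\<sigma>. Re \<mu> \<noteq> 0 \<and> - cnj \<mu> \<notin> \<sigma> \<and> x \<in> root_subspace T \<mu>) \<or>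
      (\<exists>t\<in>?I. x \<in> M t \<and> x \<in> root_subspace T (\<i> * complex_of_real t))" if "x \<in> S" for x
    using that unfolding S_def
  proof (elim UnE UN_E)
    fix \<mu> assume "\<mu> \<in> \<sigma>" "x \<in> root_subspace T \<mu>"
    then show ?thesis
      using \<sigma> by (intro disjI1 bexI[of _ \<mu>]) (auto simp: sc_set_def)
  next
    fix t assume "t \<in> ?I" "x \<in> M t"
    then show ?thesis
      using M_root by blast
  qed
  have S_neutral: "J1_form x y = 0" if "x \<in> S" "y \<in> S" for x y
  proof -
    have root: "J1_form x y = 0" if "x \<in> root_subspace T \<mu>" "y \<in> root_subspace T \<nu>" "\<mu> \<noteq> - cnj \<nu>" for \<mu> \<nu>
      using J1_orth_root_subspaces[OF hamiltonian _ that(1,2)] that(3) by (simp add: eq_neg_iff_add_eq_0)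
    from S_disj[OF that(1)] S_disj[OF that(2)] show ?thesis
    proof (elim disjE bexE conjE)
      fix \<mu> \<nu>
      assume "\<mu> \<in> \<sigma>" "- cnj \<nu> \<notin> \<sigma>" "x \<in> root_subspace T \<mu>" "y \<in> root_subspace T \<nu>"
      then show ?thesis
        by (intro root[of \<mu> \<nu>]) auto
    next
      fix \<mu> t
      assume "Re \<mu> \<noteq> 0" "x \<in> root_subspace T \<mu>" "y \<in> root_subspace T (\<i> * complex_of_real t)"
      then show ?thesis
        by (intro root[of \<mu> "\<i> * complex_of_real t"]) (auto simp: complex_eq_iff)
    next
      fix \<nu> s
      assume "Re \<nu> \<noteq> 0" "x \<in> root_subspace T (\<i> * complex_of_real s)" "y \<in> root_subspace T \<nu>"
      then show ?thesis
        by (intro root[of "\<i> * complex_of_real s" \<nu>]) (auto simp: complex_eq_iff)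
    next
      fix s t
      assume s: "s \<in> ?I" "x \<in> M s" "x \<in> root_subspace T (\<i> * complex_of_real s)"
        and t: "y \<in> M t" "y \<in> root_subspace T (\<i> * complex_of_real t)"
      show ?thesis
      proof (cases "s = t")
        case True
        then have "J1_neutral (M t)"
          using MN s(1) by (simp add: neutral_decomposition_def)
        then show ?thesis
          using s(2) t(1) True J1_neutral_orth by blast
      next
        case False
        then show ?thesis
          using s(3) t(2) by (intro root[of "\<i> * complex_of_real s" "\<i> * complex_of_real t"])
            (auto simp: complex_eq_iff)
      qed
    qed
  qed
  have U_neutral: "?U \<subseteq> J1_orth S"
    using S_neutral by (intro closure_cspan_subset_J1_orth) (auto simp only: J1_orth_def)
  have "x \<in> ?U" if x: "x \<in> J1_orth S" for x
  proof (rule in_closed_csubspace_of_P[OF U_sub closed_closure])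
    fix k
    have xS: "J1_form x y = 0" if "y \<in> S" for y
      using x that by (simp add: J1_orth_def)
    have "P k x \<in> cspan (\<Union>\<mu>. V k \<inter> root_subspace T \<mu>)"
      using V_root_decomposition[OF V_csubspace order_refl V_invariant] P_in by blast
    then obtain A g where A: "finite A" "\<And>\<nu>. \<nu> \<in> A \<Longrightarrow> g \<nu> \<in> V k \<inter> root_subspace T \<nu>"
      and Pk: "P k x = (\<Sum>\<nu>\<in>A. g \<nu>)"
      using cspan_Union_subspaces_sum[of UNIV "\<lambda>\<mu>. V k \<inter> root_subspace T \<mu>" "P k x"]
        complex_vector.subspace_inter[OF V_csubspace csubspace_root_subspace[OF T_linear]] by metis
    have "g \<mu> \<in> cspan S" if \<mu>: "\<mu> \<in> A" for \<mu>
    proof (cases "g \<mu> = 0")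
      case False
      note component = J1_form_root_component[OF A Pk \<mu> False]
      have g: "g \<mu> \<in> root_subspace T \<mu>"
        using A(2)[OF \<mu>] by blast
      then have spec: "\<mu> \<in> point_spectrum T"
        using root_subspace_trivial[OF T_linear, of \<mu>] False by blast
      show ?thesis
      proof (cases "Re \<mu> = 0")
        case True
        define t where "t = Im \<mu>"
        have t: "\<mu> = \<i> * complex_of_real t" "- cnj \<mu> = \<mu>"
          using True by (auto simp: t_def complex_eq_iff)
        have tI: "t \<in> ?I"
          using spec True t(1) by (simp add: imag_point_spectrum_def)
        then have "neutral_decomposition T \<mu> (M t) (N t)"
          using MN t(1) by simp
        then have neutral: "J1_neutral (M t)" "J1_neutral (N t)"
          and sum: "root_subspace T \<mu> = {m + n | m n. m \<in> M t \<and> n \<in> N t}"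
          by (auto simp: neutral_decomposition_def direct_sum_of_def)
        obtain m n where mn: "m \<in> M t" "n \<in> N t" "g \<mu> = m + n"
          using g sum by blast
        have M_sub: "M t \<subseteq> root_subspace T \<mu>" "M t \<subseteq> S"
          using M_root[OF tI] tI t(1) by (auto simp: S_def)
        \<comment> \<open>Let y = m' + n'. Orthogonality of \<open>x\<close> to \<open>S\<close> and
          neutrality of \<open>M t\<close> give \<langle>n|m'\<rangle> = 0, and neutrality of
          \<open>N t\<close> gives \<langle>n|n'\<rangle> = 0. So nondegeneracy will remove the
          component of \<open>g \<mu>\<close> outside \<open>M t\<close>.\<close>
        have "n \<in> J1_orth (root_subspace T (- cnj \<mu>))"
          unfolding t(2) J1_orth_def
        proof (intro CollectI ballI)
          fix y assume "y \<in> root_subspace T \<mu>"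
          then obtain m' n' where y: "y = m' + n'" "m' \<in> M t" "n' \<in> N t"
            using sum by blast
          have "J1_form (m + n) m' = 0"
            using component[of m'] subsetD[OF M_sub(1) y(2)] xS[OF subsetD[OF M_sub(2) y(2)]] t(2) mn(3)
            by simp
          moreover have "J1_form m m' = 0" "J1_form n n' = 0"
            using neutral mn y J1_neutral_orth by blast+
          ultimately show "J1_form n y = 0"
            by (simp add: y(1) J1_form_linear)
        qed
        moreover have "n \<in> root_subspace T \<mu>"
          using g mn(1,3) M_sub(1) complex_vector.subspace_diff[OF csubspace_root_subspace[OF T_linear], of "g \<mu>" \<mu> m]
          by auto
        ultimately have "n = 0"
          using root_subspace_nondegenerate by blast
        then show ?thesis
          using mn M_sub(2) complex_vector.span_base by auto
      next
        case re: False
        have "\<mu> \<in> \<sigma>"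
        proof (rule ccontr)
          \<comment> \<open>The partner then belongs to \<sigma>, so its entire root subspace lies
            in \<open>S\<close> and is orthogonal to \<open>x\<close>; this would annihilate
            \<open>g \<mu>\<close>.\<close>
          assume "\<mu> \<notin> \<sigma>"
          then have "- cnj \<mu> \<in> \<sigma>"
            using \<sigma> spec re by (auto simp: sc_set_def)
          then have root_S: "root_subspace T (- cnj \<mu>) \<subseteq> S"
            unfolding S_def by blast
          have "J1_form (g \<mu>) y = 0" if "y \<in> root_subspace T (- cnj \<mu>)" for y
            using component[OF _ that] xS[OF subsetD[OF root_S that]] by simp
          then have "g \<mu> \<in> J1_orth (root_subspace T (- cnj \<mu>))"
            unfolding J1_orth_def by blast
          then show False
            using root_subspace_nondegenerate[OF g] False by blast
        qed
        then show ?thesis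
          using g by (intro complex_vector.span_base) (auto simp: S_def)
      qed
    qed (simp add: complex_vector.span_zero)
    then have "P k x \<in> cspan S"
      unfolding Pk by (rule complex_vector.span_sum)
    then show "P k x \<in> ?U"
      using closure_subset by blast
  qed
  then have U_eq: "?U = J1_orth S"
    using U_neutral by blast
  then show "hypermaximal_J1_neutral ?U"
    unfolding hypermaximal_J1_neutral_def J1_orth_closure_cspan using U_sub by simp
  have S_dom: "y \<in> dom_op T" and S_app: "app T y \<in> S" if "y \<in> S" for y
  proof -
    show "y \<in> dom_op T"
      using S_disj[OF that] root_subspace_dom[OF T_linear] by blast
    from S_disj[OF that] show "app T y \<in> S"
    proof (elim disjE bexE conjE)
      fix \<mu> assume "\<mu> \<in> \<sigma>" "y \<in> root_subspace T \<mu>"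
      then show ?thesis
        using app_root_subspace[OF T_linear] unfolding S_def by blast
    next
      fix t assume t: "t \<in> ?I" "y \<in> M t"
      then have "invariant_op T (M t)"
        using MN by (simp add: neutral_decomposition_def)
      then have "app T y \<in> M t"
        using t \<open>y \<in> dom_op T\<close> unfolding invariant_op_def by blast
      then show ?thesis
        using t unfolding S_def by blast
    qed
  qed
  show "invariant_op T ?U"
    unfolding invariant_op_def
  proof (intro image_subsetI)
    fix x assume x: "x \<in> ?U \<inter> dom_op T"
    \<comment> \<open>As \<open>T\<close> may be unbounded, invariance does not pass to the closure
      by continuity. It follows instead from \<open>?U = J1_orth S\<close>: skew-symmetry moves
      \<open>T\<close> onto \<open>y\<close>, and \<open>S\<close> is mapped into itself.\<close>
    have "J1_form (app T x) y = 0" if "y \<in> S" for y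
    proof -
      have "J1_form x (app T y) = 0"
        using x U_eq S_app[OF that] by (simp add: J1_orth_def)
      then show ?thesis
        using hamiltonian_skew_symmetric[OF hamiltonian _ S_dom[OF that], of x] x by simp
    qed
    then show "app T x \<in> ?U"
      unfolding U_eq J1_orth_def by blast
  qed
  show "compatible_subspace V ?U"
    unfolding compatible_subspace_def
  \<comment> \<open>The largest possible pieces are taken; they generate because each vector of
    \<open>S\<close> is a root vector and thus lies in one \<open>V k\<close>.\<close>
  proof (intro exI[of _ "\<lambda>k. ?U \<inter> V k"] conjI allI)
    show "?U = closure (subspace_sum (\<lambda>k. ?U \<inter> V k))"
    proof
      have "S \<subseteq> (\<Union>k. ?U \<inter> V k)"
      proof
        fix x assume "x \<in> S"
        then obtain \<mu> where "x \<in> root_subspace T \<mu>"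
          using S_disj by blast
        then obtain k where "x \<in> V k"
          using root_subspace_subset_V by blast
        then show "x \<in> (\<Union>k. ?U \<inter> V k)"
          using \<open>x \<in> S\<close> SU by blast
      qed
      then show "?U \<subseteq> closure (subspace_sum (\<lambda>k. ?U \<inter> V k))"
        unfolding subspace_sum_def by (intro closure_mono complex_vector.span_mono)
      show "closure (subspace_sum (\<lambda>k. ?U \<inter> V k)) \<subseteq> ?U"
        unfolding subspace_sum_def
        by (intro closure_minimal complex_vector.span_minimal U_sub closed_closure) blast
    qed
  qed (auto intro: complex_vector.subspace_inter U_sub V_csubspace closed_Int V_closed)
qed

section \<open>Necessity: neutral decompositions from a given hypermaximal subspace\<close>

theorem neutral_decomposition_of_hypermaximal:
  assumes U: "hypermaximal_J1_neutral U" "invariant_op T U" "compatible_subspace V U"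
  obtains N where "neutral_decomposition T (\<i> * complex_of_real t)
    (U \<inter> root_subspace T (\<i> * complex_of_real t)) N"
proof -
  define \<mu> where "\<mu> = \<i> * complex_of_real t"
  define M where "M = U \<inter> root_subspace T \<mu>"
  let ?L = "root_subspace T \<mu>"
  have \<mu>: "- cnj \<mu> = \<mu>"
    by (simp add: \<mu>_def)
  have U_sub: "csubspace U" and U_eq: "U = J1_orth U"
    using U(1) by (auto simp: hypermaximal_J1_neutral_def)
  have L_sub: "csubspace ?L"
    by (rule csubspace_root_subspace[OF T_linear])
  have M_sub: "csubspace M"
    unfolding M_def by (rule complex_vector.subspace_inter[OF U_sub L_sub])
  obtain W where W: "\<And>k. W k \<subseteq> V k" "U = closure (cspan (\<Union>k. W k))"
    using U(3) unfolding compatible_subspace_def subspace_sum_def by blast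
  obtain k where "?L \<subseteq> V k"
    using root_subspace_subset_V by blast
  then have L_fd: "finite_dimensional ?L"
    using finite_dimensional_csubspace[OF L_sub V_finite_dimensional] by blast
  have "x \<in> U" if x: "x \<in> ?L" "x \<in> J1_orth M" for x
  proof -
    have "W j \<subseteq> J1_orth {x}" for j
    proof -
      \<comment> \<open>The piece \<open>W j\<close> is not known to be invariant, whereas U
        \<inter> V j is, and it contains \<open>W j\<close>. Its root vectors for \<mu> lie in
        \<open>M\<close>; those for other eigenvalues are orthogonal to \<open>x\<close>
        anyway.\<close>
      let ?W = "U \<inter> V j"
      have "csubspace ?W" "invariant_op T ?W"
        using complex_vector.subspace_inter[OF U_sub V_csubspace] U(2) V_invariant[of j]
        unfolding invariant_op_def by blast+
      then have "?W \<subseteq> cspan (\<Union>\<nu>. ?W \<inter> root_subspace T \<nu>)"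
        by (intro V_root_decomposition[of _ j]) auto
      also have "\<dots> \<subseteq> J1_orth {x}"
      proof (intro complex_vector.span_minimal csubspace_J1_orth UN_least)
        fix \<nu>
        have "J1_form y x = 0" if y: "y \<in> ?W \<inter> root_subspace T \<nu>" for y
        proof (cases "\<nu> = \<mu>")
          case True
          then have "y \<in> M"
            using y unfolding M_def by blast
          then show ?thesis
            using x(2) J1_form_zero_commute[of y x] by (simp add: J1_orth_def)
        next
          case False
          then have "\<nu> + cnj \<mu> \<noteq> 0"
            using \<mu> by (metis add.inverse_unique add.commute minus_minus)
          then show ?thesis
            using J1_orth_root_subspaces[OF hamiltonian _ _ x(1)] y by blast
        qed
        then show "?W \<inter> root_subspace T \<nu> \<subseteq> J1_orth {x}"
          unfolding J1_orth_def by blast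
      qed
      finally have "?W \<subseteq> J1_orth {x}" .
      moreover have "W j \<subseteq> U"
        using subset_trans[OF complex_vector.span_superset[of "\<Union>k. W k"] closure_subset]
        unfolding W(2) by blast
      ultimately show ?thesis
        using W(1) by blast
    qed
    then have "U \<subseteq> J1_orth {x}"
      unfolding W(2) by (intro closure_cspan_subset_J1_orth) blast
    then have "{x} \<subseteq> J1_orth U"
      by (simp add: subset_J1_orth_commute)
    then show ?thesis
      using U_eq by blast
  qed
  moreover have "U \<subseteq> J1_orth M"
    using U_eq unfolding M_def J1_orth_def by blast
  ultimately have lag: "M = ?L \<inter> J1_orth M"
    unfolding M_def by blast
  \<comment> \<open>For imaginary \<mu> the partner - cnj \<mu> is \<mu> itself, so the pairing is
    the form restricted to the root subspace.\<close>
  have nondeg: "?L \<inter> J1_orth ?L = {0}"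
    using root_subspace_nondegenerate[of _ \<mu>] complex_vector.subspace_0[OF L_sub]
      complex_vector.subspace_0[OF csubspace_J1_orth] unfolding \<mu> by blast
  obtain N where N: "J1_neutral N" "direct_sum_of ?L M N"
    by (rule J1_neutral_complement_exists[OF L_sub L_fd M_sub nondeg lag])
  have "J1_neutral M"
    using M_sub lag unfolding J1_neutral_def J1_orth_def by blast
  moreover have "invariant_op T M"
    using U(2) app_root_subspace[OF T_linear] unfolding M_def invariant_op_def by blast
  ultimately have "neutral_decomposition T \<mu> M N"
    using N by (simp add: neutral_decomposition_def)
  then show ?thesis
    using that unfolding M_def \<mu>_def by blast
qed

text \<open>One member of each pair \<mu>, - cnj \<mu> is selected by the sign of the real part,
  which requires the symmetry of the point spectrum. It furnishes the sc-set with which the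
  decompositions yield the existence of a suitable \<open>U\<close>.\<close>

lemma sc_set_right_half_plane: "sc_set T (point_spectrum T \<inter> {\<mu>. Re \<mu> > 0})"
  using point_spectrum_symmetric by (auto simp: sc_set_def)

end

theorem theorem5p2:
  fixes T :: "('h::chilbert_space \<times> 'h) lin_op"
    and V :: "nat \<Rightarrow> ('h \<times> 'h) set"
  assumes separable: "separable_space (euclidean :: 'h topology)"
    and hamiltonian: "hamiltonian T"
    and closed: "closed_op T"
    and basis: "finitely_spectral T V"
  shows "((\<exists>U. hypermaximal_J1_neutral U \<and> invariant_op T U \<and> compatible_subspace V U) \<longleftrightarrow>
      (\<forall>t::real. \<i> * complex_of_real t \<in> imag_point_spectrum T \<longrightarrow>
        (\<exists>M N. neutral_decomposition T (\<i> * complex_of_real t) M N)))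
    \<and> (\<forall>M N \<sigma>.
      (\<forall>t::real. \<i> * complex_of_real t \<in> imag_point_spectrum T \<longrightarrow>
        neutral_decomposition T (\<i> * complex_of_real t) (M t) (N t)) \<longrightarrow>
      sc_set T \<sigma> \<longrightarrow>
      (let U = closure (cspan
          ((\<Union>\<mu>\<in>\<sigma>. root_subspace T \<mu>) \<union>
           (\<Union>t\<in>{t. \<i> * complex_of_real t \<in> imag_point_spectrum T}. M t)))
       in hypermaximal_J1_neutral U \<and> invariant_op T U \<and> compatible_subspace V U))"
proof -
  obtain P where "riesz_projections V P"
    using riesz_projections_exist basis unfolding finitely_spectral_def by metis
  then interpret spectral_hamiltonian V P T
    using hamiltonian closed basis
    by (simp add: spectral_hamiltonian_def spectral_hamiltonian_axioms_def)
  have construction: "\<forall>M N \<sigma>.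
      (\<forall>t::real. \<i> * complex_of_real t \<in> imag_point_spectrum T \<longrightarrow>
        neutral_decomposition T (\<i> * complex_of_real t) (M t) (N t)) \<longrightarrow>
      sc_set T \<sigma> \<longrightarrow>
      (let U = closure (cspan
          ((\<Union>\<mu>\<in>\<sigma>. root_subspace T \<mu>) \<union>
           (\<Union>t\<in>{t. \<i> * complex_of_real t \<in> imag_point_spectrum T}. M t)))
       in hypermaximal_J1_neutral U \<and> invariant_op T U \<and> compatible_subspace V U)"
    unfolding Let_def by (intro allI impI conjI hypermaximal_of_neutral_decompositions) blast+
  moreover have "(\<exists>U. hypermaximal_J1_neutral U \<and> invariant_op T U \<and> compatible_subspace V U) \<longleftrightarrow>
      (\<forall>t::real. \<i> * complex_of_real t \<in> imag_point_spectrum T \<longrightarrow>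
        (\<exists>M N. neutral_decomposition T (\<i> * complex_of_real t) M N))"
  proof
    assume "\<exists>U. hypermaximal_J1_neutral U \<and> invariant_op T U \<and> compatible_subspace V U"
    then show "\<forall>t::real. \<i> * complex_of_real t \<in> imag_point_spectrum T \<longrightarrow>
        (\<exists>M N. neutral_decomposition T (\<i> * complex_of_real t) M N)"
      using neutral_decomposition_of_hypermaximal by metis
  next
    assume "\<forall>t::real. \<i> * complex_of_real t \<in> imag_point_spectrum T \<longrightarrow>
        (\<exists>M N. neutral_decomposition T (\<i> * complex_of_real t) M N)"
    then obtain M N where "\<forall>t::real. \<i> * complex_of_real t \<in> imag_point_spectrum T \<longrightarrow>
        neutral_decomposition T (\<i> * complex_of_real t) (M t) (N t)"
      by metis
    then show "\<exists>U. hypermaximal_J1_neutral U \<and> invariant_op T U \<and> compatible_subspace V U"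
      using construction sc_set_right_half_plane unfolding Let_def by blast
  qed
  ultimately show ?thesis
    by blast
qed

end
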